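(* Let $W=(W_{s,t},(s,t)\in[0,1]^2)$ be a $d$-dimensional Brownian sheet on a filtered probability space $(\Omega,\mathcal F,(\mathcal F_{s,t}),\mathbb P)$, vanishing on the axes. Suppose $b:[0,1]^2\times\mathbb R^d\to\mathbb R^d$ satisfies Hypothesis (H). Then there is an event $\Omega_\infty\subset\Omega$ with $\mathbb P(\Omega_\infty)=1$ such that for every $\omega\in\Omega_\infty$ there exists exactly one continuous function $X:[0,1]^2\to\mathbb R^d$ satisfying $$X_{s,t}=\int_0^t\int_0^s b(\xi,\zeta,X_{\xi,\zeta})\,d\xi\,d\zeta+W_{s,t}(\omega)\qquad\text{for all }(s,t)\in[0,1]^2.$$
   Context: Hypothesis (H): (i) $b:[0,1]^2\times\mathbb R^d\to\mathbb R^d$ is Borel measurable and there is a constant $M$ with $|b(s,t,x)|\le M(1+|x|)$ for all $(s,t,x)\in[0,1]^2\times\mathbb R^d$; (ii) $b$ is componentwise nondecreasing in space: for $x,y\in\mathbb R^d$ with $x_i\le y_i$ for all $i$, one has $b_i(s,t,x)\le b_i(s,t,y)$ for every component $i=1,\dots,d$ and every $(s,t)$. A filtered probability space here means $(\Omega,\mathcal F,\mathbb P)$ with a family of sub-$\sigma$-algebras $(\mathcal F_{s,t})$, nondecreasing for the coordinatewise order, right-continuous, with $\mathcal F_{0,0}$ containing the null sets. A one-dimensional $(\mathcal F_{s,t})$-Brownian sheet is an adapted process with continuous paths such that for every rectangle $]s,s']\times]t,t']$ the increment $W_{s',t'}-W_{s,t'}-W_{s',t}+W_{s,t}$ is centered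 Gaussian with variance $(s'-s)(t'-t)$ and independent of $\mathcal F_{s,1}\vee\mathcal F_{1,t}$; a $d$-dimensional Brownian sheet has $d$ independent such components. Here $W$ vanishes on $\{0\}\times[0,1]\cup[0,1]\times\{0\}$. $|\cdot|$ is the Euclidean norm. *)

theory Defs
  imports "HOL-Probability.Probability"
begin

definition unit_sq :: "(real \<times> real) set" where
  "unit_sq = {0..1} \<times> {0..1}"

definition filtration2 :: "'w measure \<Rightarrow> (real \<times> real \<Rightarrow> 'w measure) \<Rightarrow> bool" where
  "filtration2 M F \<longleftrightarrow>
     (\<forall>z\<in>unit_sq. subalgebra M (F z)) \<and>
     (\<forall>s t s' t'. (s, t) \<in> unit_sq \<longrightarrow> (s', t') \<in> unit_sq \<longrightarrow> s \<le> s' \<longrightarrow> t \<le> t' \<longrightarrow>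
        sets (F (s, t)) \<subseteq> sets (F (s', t'))) \<and>
     (\<forall>s t. (s, t) \<in> unit_sq \<longrightarrow>
        sets (F (s, t)) = (\<Inter>e\<in>{0<..}. sets (F (min (s + e) 1, min (t + e) 1)))) \<and>
     null_sets M \<subseteq> sets (F (0, 0))"

definition rect_incr ::
  "(real \<times> real \<Rightarrow> 'w \<Rightarrow> real ^ 'd) \<Rightarrow> 'd \<Rightarrow> real \<Rightarrow> real \<Rightarrow> real \<Rightarrow> real \<Rightarrow> 'w \<Rightarrow> real" where
  "rect_incr W i s t s' t' \<omega> =
     W (s', t') \<omega> $ i - W (s, t') \<omega> $ i - W (s', t) \<omega> $ i + W (s, t) \<omega> $ i"

definition brownian_sheet ::
  "'w measure \<Rightarrow> (real \<times> real \<Rightarrow> 'w measure) \<Rightarrow> (real \<times> real \<Rightarrow> 'w \<Rightarrow> real ^ 'd) \<Rightarrow> bool" where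
  "brownian_sheet M F W \<longleftrightarrow>
     (\<forall>z\<in>unit_sq. W z \<in> borel_measurable (F z)) \<and>
     (\<forall>\<omega>\<in>space M. continuous_on unit_sq (\<lambda>z. W z \<omega>)) \<and>
     (\<forall>\<omega>\<in>space M. \<forall>u\<in>{0..1}. W (0, u) \<omega> = 0 \<and> W (u, 0) \<omega> = 0) \<and>
     (\<forall>i s t s' t'. 0 \<le> s \<longrightarrow> s < s' \<longrightarrow> s' \<le> 1 \<longrightarrow> 0 \<le> t \<longrightarrow> t < t' \<longrightarrow> t' \<le> 1 \<longrightarrow>
        distributed M lborel (rect_incr W i s t s' t')
          (normal_density 0 (sqrt ((s' - s) * (t' - t)))) \<and>
        prob_space.indep_set M
          {rect_incr W i s t s' t' -` A \<inter> space M | A. A \<in> sets borel}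
          (sigma_sets (space M) (sets (F (s, 1)) \<union> sets (F (1, t))))) \<and>
     prob_space.indep_vars M (\<lambda>i. PiM unit_sq (\<lambda>_. borel))
        (\<lambda>i \<omega>. \<lambda>z\<in>unit_sq. W z \<omega> $ i) UNIV"

end

theory Submission
  imports Defs
begin

text \<open>
  For a bounded monotone drift, Picard iteration from above with the right-continuous
  regularisation of the drift converges to a process \<open>X\<^sup>+\<close> that dominates every solution;
  symmetrically there is a smallest \<open>X\<^sup>-\<close>. Both are measurable functionals of the driving path.
  Translating the path by \<open>3 * C\<close> times the area of the part of \<open>[0, s] \<times> [0, t]\<close> within distance \<open>r\<close>
  of the axes pushes \<open>X\<^sup>-\<close> above the untranslated \<open>X\<^sup>+\<close>: near the axes the push beats the
  drift difference, and beyond them monotonicity preserves the order. This translation is a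
  Cameron-Martin direction whose norm tends to \<open>0\<close> with \<open>r\<close>, so the law of the translated
  sheet tends to that of the sheet in total variation. Hence \<open>X\<^sup>+\<close> and \<open>X\<^sup>-\<close> have the same
  arctangent expectations and, being ordered, coincide almost surely, which gives existence and
  uniqueness at once. Linear growth is reduced to bounded drifts by truncation and Gronwall's
  inequality.
\<close>

section \<open>Box integrals and the regularised drift\<close>

text \<open>Noise is essential: for \<open>d = 1\<close>, zero driving path and \<open>b\<close> the
  indicator of \<open>x > 0\<close>, both \<open>0\<close> and \<open>s * t\<close> are solutions. A
  monotone drift may also jump, so a limit of iterates solves only the equation with a regularised
  drift; the original equation comes back once the two extremal solutions agree. The shape of the
  translation is forced. Its mixed derivative must exceed \<open>2 * C\<close>, the largest possible
  gap between two drifts, wherever the strict order is not yet established; \<open>3 * C\<close> is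
  one such constant. A small multiple of \<open>s * t\<close> would fail. With the height fixed only
  the support can shrink, and an L-shaped strip along the axes is enough, since every rectangle
  issuing from the origin enters it before anything else. The squared Cameron-Martin norm is
  \<open>d * (3 * C)\<^sup>2\<close> times the area of the strip. No stochastic integral occurs: the
  translation is deterministic, and on dyadic cells it is a product of one-dimensional Gaussian
  shifts. Total variation controls bounded functionals only, which is why a bounded strictly
  increasing function is applied before expectations are taken.\<close>

lemma borel_measurable_vecI:
  fixes f :: "'a \<Rightarrow> real ^ 'n"
  assumes "\<And>i. (\<lambda>x. f x $ i) \<in> borel_measurable M"
  shows "f \<in> borel_measurable M"
proof (rule borel_measurable_euclidean_space[THEN iffD2], rule ballI)
  fix b :: "real ^ 'n" assume "b \<in> Basis"
  then obtain i where "b = axis i 1" by (auto simp: Basis_vec_def)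
  then show "(\<lambda>x. f x \<bullet> b) \<in> borel_measurable M" using assms[of i] by (simp add: inner_axis)
qed

lemma borel_measurable_vec_nth [measurable (raw)]:
  fixes f :: "'a \<Rightarrow> real ^ 'n"
  assumes "f \<in> borel_measurable M"
  shows "(\<lambda>x. f x $ i) \<in> borel_measurable M"
  using borel_measurable_continuous_on[OF _ assms, of "\<lambda>v. v $ i"]
  by (simp add: continuous_on_component continuous_on_id)

lemma mem_cbox_0:
  fixes z p :: "real \<times> real"
  shows "p \<in> cbox 0 z \<longleftrightarrow> 0 \<le> fst p \<and> fst p \<le> fst z \<and> 0 \<le> snd p \<and> snd p \<le> snd z"
  by (cases p; cases z) (auto simp: zero_prod_def cbox_Pair_eq)

lemma measure_cbox_0:
  fixes z :: "real \<times> real"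
  assumes "0 \<le> fst z" "0 \<le> snd z"
  shows "measure lborel (cbox 0 z) = fst z * snd z"
  using assms by (cases z) (simp add: zero_prod_def content_Pair)

lemma set_integrable_box:
  fixes f :: "real \<times> real \<Rightarrow> real"
  assumes [measurable]: "f \<in> borel_measurable borel" and "\<And>p. \<bar>f p\<bar> \<le> B"
  shows "set_integrable lborel (cbox a z) f"
proof -
  have "integrable lborel (\<lambda>p. indicator (cbox a z) p *\<^sub>R B)"
    by (intro integrable_scaleR_left integrable_real_indicator) (auto simp: emeasure_lborel_cbox_eq)
  then show ?thesis
    unfolding set_integrable_def
  proof (rule Bochner_Integration.integrable_bound)
    show "AE p in lborel. norm (indicat_real (cbox a z) p *\<^sub>R f p) \<le> norm (indicat_real (cbox a z) p *\<^sub>R B)"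
      using order_trans[OF assms(2) abs_ge_self] by (intro AE_I2) (simp add: indicator_def)
  qed simp
qed

text \<open>The componentwise form lets scalar order and convergence arguments apply directly;
  \<open>box_integral_eq_set_integral\<close> identifies it with the Bochner integral.\<close>

definition box_integral :: "(real \<times> real \<Rightarrow> real ^ 'd) \<Rightarrow> real \<times> real \<Rightarrow> real ^ 'd" where
  "box_integral f z = (\<chi> i. LINT p:cbox 0 z|lborel. f p $ i)"

lemma box_integral_nth: "box_integral f z $ i = (LINT p:cbox 0 z|lborel. f p $ i)"
  by (simp add: box_integral_def)

lemma box_integral_cong:
  assumes "\<And>p. p \<in> cbox 0 z \<Longrightarrow> f p = g p"
  shows "box_integral f z = box_integral g z"
proof (rule vec_eq_iff[THEN iffD2], rule allI)
  show "box_integral f z $ i = box_integral g z $ i" for i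
    unfolding box_integral_nth by (rule set_lebesgue_integral_cong) (auto simp: assms)
qed

text \<open>Dominated convergence along sequences: the indicators of the boxes can fail to converge
  only on the two lines through the upper right corner, which are null sets.\<close>

lemma continuous_box_integral:
  fixes f :: "real \<times> real \<Rightarrow> real"
  assumes [measurable]: "f \<in> borel_measurable borel" and B: "\<And>p. \<bar>f p\<bar> \<le> B"
  shows "continuous_on unit_sq (\<lambda>z. LINT p:cbox 0 z|lborel. f p)"
  unfolding continuous_on_sequentially comp_def
proof (intro allI ballI impI, elim conjE)
  fix x z assume z: "z \<in> unit_sq" and x: "\<forall>n. x n \<in> unit_sq" "x \<longlonglongrightarrow> z"
  show "(\<lambda>n. LINT p:cbox 0 (x n)|lborel. f p) \<longlonglongrightarrow> (LINT p:cbox 0 z|lborel. f p)"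
    unfolding set_lebesgue_integral_def
  proof (rule integral_dominated_convergence)
    show "integrable lborel (\<lambda>p::real \<times> real. indicator (cbox 0 (1,1)) p *\<^sub>R B)"
      using set_integrable_box[of "\<lambda>_. B" "\<bar>B\<bar>" 0 "(1,1)"] by (simp add: set_integrable_def)
    show "AE p in lborel. norm (indicat_real (cbox 0 (x n)) p *\<^sub>R f p) \<le> indicator (cbox 0 (1,1)) p *\<^sub>R B" for n
    proof (rule AE_I2)
      fix p
      have "x n \<in> unit_sq" using x by auto
      then have "p \<in> cbox 0 (x n) \<Longrightarrow> p \<in> cbox 0 (1,1)"
        by (auto simp: mem_cbox_0 unit_sq_def mem_Times_iff)
      moreover have "0 \<le> B" using B[of 0] by simp
      ultimately show "norm (indicat_real (cbox 0 (x n)) p *\<^sub>R f p) \<le> indicator (cbox 0 (1,1)) p *\<^sub>R B"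
        using B[of p] by (auto simp: indicator_def)
    qed
    have 1: "AE p::real \<times> real in lborel. fst p \<noteq> fst z"
    proof -
      have "emeasure (lborel \<Otimes>\<^sub>M lborel) ({fst z} \<times> (UNIV::real set)) = 0"
        by (subst lborel.emeasure_pair_measure_Times) auto
      then show ?thesis
        by (intro AE_I[where N="{fst z} \<times> (UNIV::real set)"]) (auto simp: lborel_prod intro!: borel_closed closed_Times)
    qed
    have 2: "AE p::real \<times> real in lborel. snd p \<noteq> snd z"
    proof -
      have "emeasure (lborel \<Otimes>\<^sub>M lborel) ((UNIV::real set) \<times> {snd z}) = 0"
        by (subst lborel.emeasure_pair_measure_Times) auto
      then show ?thesis
        by (intro AE_I[where N="(UNIV::real set) \<times> {snd z}"]) (auto simp: lborel_prod intro!: borel_closed closed_Times)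
    qed
    show "AE p in lborel. (\<lambda>n. indicat_real (cbox 0 (x n)) p *\<^sub>R f p) \<longlonglongrightarrow> indicator (cbox 0 z) p *\<^sub>R f p"
      using 1 2
    proof eventually_elim
      fix p :: "real \<times> real" assume p: "fst p \<noteq> fst z" "snd p \<noteq> snd z"
      have f: "(\<lambda>n. fst (x n)) \<longlonglongrightarrow> fst z" and s: "(\<lambda>n. snd (x n)) \<longlonglongrightarrow> snd z"
        using x by (auto intro: tendsto_intros)
      have "\<forall>\<^sub>F n in sequentially. fst p \<le> fst (x n) \<longleftrightarrow> fst p \<le> fst z"
      proof (cases "fst p < fst z")
        case True then show ?thesis using order_tendstoD(1)[OF f True] by (auto elim: eventually_mono)
      next
        case False
        then have "fst z < fst p" using p by auto
        then show ?thesis using order_tendstoD(2)[OF f, of "fst p"] by (auto elim: eventually_mono)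
      qed
      moreover have "\<forall>\<^sub>F n in sequentially. snd p \<le> snd (x n) \<longleftrightarrow> snd p \<le> snd z"
      proof (cases "snd p < snd z")
        case True then show ?thesis using order_tendstoD(1)[OF s True] by (auto elim: eventually_mono)
      next
        case False
        then have "snd z < snd p" using p by auto
        then show ?thesis using order_tendstoD(2)[OF s, of "snd p"] by (auto elim: eventually_mono)
      qed
      ultimately have "\<forall>\<^sub>F n in sequentially. indicat_real (cbox 0 (x n)) p *\<^sub>R f p = indicator (cbox 0 z) p *\<^sub>R f p"
        by eventually_elim (auto simp: indicator_def mem_cbox_0)
      then show "(\<lambda>n. indicat_real (cbox 0 (x n)) p *\<^sub>R f p) \<longlonglongrightarrow> indicator (cbox 0 z) p *\<^sub>R f p"
        by (rule tendsto_eventually)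
    qed
  qed simp_all
qed

text \<open>By monotonicity the diagonal sequence already realises the infimum over all points
  strictly above \<open>x\<close> in every coordinate, and a countable infimum keeps
  measurability.\<close>

definition upper_drift :: "(real \<times> real \<Rightarrow> real ^ 'd \<Rightarrow> real ^ 'd) \<Rightarrow> real \<times> real \<Rightarrow> real ^ 'd \<Rightarrow> real ^ 'd" where
  "upper_drift \<beta> z x = (\<chi> i. INF n. \<beta> z (x + vec (1 / real (Suc n))) $ i)"

text \<open>Conjugation with \<open>x \<mapsto> - x\<close> preserves monotonicity and the bound but
  reverses the order of solutions, so everything about smallest solutions is read off from largest
  ones.\<close>

definition reflect_drift :: "(real \<times> real \<Rightarrow> real ^ 'd \<Rightarrow> real ^ 'd) \<Rightarrow> real \<times> real \<Rightarrow> real ^ 'd \<Rightarrow> real ^ 'd" where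
  "reflect_drift \<beta> z x = - \<beta> z (- x)"

text \<open>The starting path dominates every solution because each component of the drift is at
  most \<open>C\<close>.\<close>

primrec upper_iter ::
  "(real \<times> real \<Rightarrow> real ^ 'd \<Rightarrow> real ^ 'd) \<Rightarrow> real \<Rightarrow> (real \<times> real \<Rightarrow> real ^ 'd) \<Rightarrow> nat \<Rightarrow> real \<times> real \<Rightarrow> real ^ 'd" where
  "upper_iter \<beta> C w 0 = (\<lambda>z. w z + vec (C * (fst z * snd z)))"
| "upper_iter \<beta> C w (Suc n) = (\<lambda>z. box_integral (\<lambda>p. upper_drift \<beta> p (upper_iter \<beta> C w n p)) z + w z)"

text \<open>\<open>lim\<close> is total, so measurability in the path needs no convergence.
  Convergence is available at points with nonnegative coordinates.\<close>

definition upper_sol ::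
  "(real \<times> real \<Rightarrow> real ^ 'd \<Rightarrow> real ^ 'd) \<Rightarrow> real \<Rightarrow> (real \<times> real \<Rightarrow> real ^ 'd) \<Rightarrow> real \<times> real \<Rightarrow> real ^ 'd" where
  "upper_sol \<beta> C w z = (\<chi> i. lim (\<lambda>n. upper_iter \<beta> C w n z $ i))"

definition lower_sol ::
  "(real \<times> real \<Rightarrow> real ^ 'd \<Rightarrow> real ^ 'd) \<Rightarrow> real \<Rightarrow> (real \<times> real \<Rightarrow> real ^ 'd) \<Rightarrow> real \<times> real \<Rightarrow> real ^ 'd" where
  "lower_sol \<beta> C w z = - upper_sol (reflect_drift \<beta>) C (\<lambda>z. - w z) z"

text \<open>Bound and monotonicity are asked for on the whole plane, which spares side conditions; a
  drift given on the square is later extended by zero.\<close>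

locale monotone_drift =
  fixes \<beta> :: "real \<times> real \<Rightarrow> real ^ 'd \<Rightarrow> real ^ 'd" and C :: real
  assumes drift_measurable: "(\<lambda>(z, x). \<beta> z x) \<in> borel_measurable (borel \<Otimes>\<^sub>M borel)"
    and drift_bound: "\<bar>\<beta> z x $ i\<bar> \<le> C"
    and drift_mono: "(\<And>j. x $ j \<le> y $ j) \<Longrightarrow> \<beta> z x $ i \<le> \<beta> z y $ i"
begin

lemma drift_ge: "- C \<le> \<beta> z x $ i"
  using drift_bound[of z x i] by linarith

lemma drift_le: "\<beta> z x $ i \<le> C"
  using drift_bound[of z x i] by linarith

lemma C_nonneg: "0 \<le> C"
  using drift_bound[of 0 0 undefined] by linarith

lemma drift_comp_measurable:
  assumes [measurable]: "f \<in> borel_measurable N" "X \<in> borel_measurable N"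
  shows "(\<lambda>x. \<beta> (f x) (X x)) \<in> borel_measurable N"
proof -
  have "(\<lambda>x. (f x, X x)) \<in> N \<rightarrow>\<^sub>M borel \<Otimes>\<^sub>M borel" by simp
  from measurable_compose[OF this drift_measurable] show ?thesis by simp
qed

lemma monotone_drift_reflect: "monotone_drift (reflect_drift \<beta>) C"
proof
  have [measurable]: "(\<lambda>p::(real \<times> real) \<times> (real ^ 'd). \<beta> (fst p) (- snd p)) \<in> borel_measurable (borel \<Otimes>\<^sub>M borel)"
    by (rule drift_comp_measurable) auto
  show "(\<lambda>(z, x). reflect_drift \<beta> z x) \<in> borel_measurable (borel \<Otimes>\<^sub>M borel)"
    unfolding reflect_drift_def split_beta' by measurable
qed (auto simp: reflect_drift_def drift_bound intro!: drift_mono)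

lemma upper_bdd: "bdd_below (range (\<lambda>n. \<beta> z (x + vec (1 / real (Suc n))) $ i))"
  by (rule bdd_belowI2[OF drift_ge])

lemma upper_drift_le_shift: "upper_drift \<beta> z x $ i \<le> \<beta> z (x + vec (1 / real (Suc n))) $ i"
  unfolding upper_drift_def vec_lambda_beta by (rule cINF_lower[OF upper_bdd]) simp

lemma upper_drift_le_strict:
  assumes "\<And>j. x $ j < y $ j"
  shows "upper_drift \<beta> z x $ i \<le> \<beta> z y $ i"
proof -
  have "\<forall>\<^sub>F n in sequentially. \<forall>j. x $ j + 1 / real (Suc n) < y $ j"
  proof (rule eventually_all_finite)
    fix j
    have "(\<lambda>n. x $ j + 1 / real (Suc n)) \<longlonglongrightarrow> x $ j + 0"
      by (intro tendsto_intros) real_asymp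
    then show "\<forall>\<^sub>F n in sequentially. x $ j + 1 / real (Suc n) < y $ j"
      using assms[of j] by (auto dest: order_tendstoD)
  qed
  then obtain n where "\<forall>j. x $ j + 1 / real (Suc n) < y $ j"
    using eventually_happens trivial_limit_sequentially by blast
  then have "\<beta> z (x + vec (1 / real (Suc n))) $ i \<le> \<beta> z y $ i"
    by (intro drift_mono) (auto simp: less_imp_le)
  then show ?thesis using upper_drift_le_shift[of z x i n] by linarith
qed

lemma le_upper_drift: "\<beta> z x $ i \<le> upper_drift \<beta> z x $ i"
  unfolding upper_drift_def vec_lambda_beta by (rule cINF_greatest) (auto intro!: drift_mono)

lemma monotone_drift_upper: "monotone_drift (upper_drift \<beta>) C"
proof
  have [measurable]: "(\<lambda>p::(real \<times> real) \<times> (real ^ 'd). \<beta> (fst p) (snd p + vec (1 / real (Suc n))) $ i) \<in> borel_measurable (borel \<Otimes>\<^sub>M borel)" for n i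
    by (intro borel_measurable_vec_nth drift_comp_measurable) auto
  show "(\<lambda>(z, x). upper_drift \<beta> z x) \<in> borel_measurable (borel \<Otimes>\<^sub>M borel)"
    unfolding split_beta'
  proof (rule borel_measurable_vecI)
    fix i
    show "(\<lambda>p. upper_drift \<beta> (fst p) (snd p) $ i) \<in> borel_measurable (borel \<Otimes>\<^sub>M borel)"
      unfolding upper_drift_def vec_lambda_beta
      by (rule borel_measurable_cINF) (auto intro!: upper_bdd simp del: of_nat_Suc)
  qed
  show "\<bar>upper_drift \<beta> z x $ i\<bar> \<le> C" for z x i
    using upper_drift_le_shift[of z x i 0] le_upper_drift[of z x i] drift_ge[of z x i]
      drift_le[of z "x + vec (1 / real (Suc 0))" i] by linarith
  show "upper_drift \<beta> z x $ i \<le> upper_drift \<beta> z y $ i" if "\<And>j. x $ j \<le> y $ j" for x y z i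
    unfolding upper_drift_def vec_lambda_beta
  proof (rule cINF_mono[OF _ upper_bdd])
    show "\<exists>m\<in>UNIV. \<beta> z (x + vec (1 / real (Suc m))) $ i \<le> \<beta> z (y + vec (1 / real (Suc n))) $ i" for n
      using that by (intro bexI[of _ n] drift_mono) auto
  qed simp
qed

text \<open>Approach from above is essential. The lower estimate is monotonicity; for the upper one,
  a shift that brings \<open>\<beta>\<close> below \<open>a\<close> leaves room for all late
  \<open>X n\<close> strictly beneath the shifted point.\<close>

lemma upper_drift_right_continuous:
  assumes "\<And>n j. x $ j \<le> X n $ j" and "\<And>j. (\<lambda>n. X n $ j) \<longlonglongrightarrow> x $ j"
  shows "(\<lambda>n. upper_drift \<beta> z (X n) $ i) \<longlonglongrightarrow> upper_drift \<beta> z x $ i"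
proof (rule order_tendstoI)
  interpret u: monotone_drift "upper_drift \<beta>" C by (rule monotone_drift_upper)
  fix a
  show "\<forall>\<^sub>F n in sequentially. a < upper_drift \<beta> z (X n) $ i" if "a < upper_drift \<beta> z x $ i"
    using less_le_trans[OF that u.drift_mono[OF assms(1)]] by (intro always_eventually allI)
  assume "upper_drift \<beta> z x $ i < a"
  then obtain m where m: "\<beta> z (x + vec (1 / real (Suc m))) $ i < a"
    unfolding upper_drift_def using upper_bdd[of z x i] by (auto simp: cINF_less_iff)
  have "\<forall>\<^sub>F n in sequentially. \<forall>j. X n $ j < (x + vec (1 / real (Suc m))) $ j"
    by (intro eventually_all_finite order_tendstoD(2)[OF assms(2)]) simp
  then show "\<forall>\<^sub>F n in sequentially. upper_drift \<beta> z (X n) $ i < a"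
  proof eventually_elim
    case (elim n)
    then show ?case using upper_drift_le_strict[of "X n" "x + vec (1 / real (Suc m))" z i] m by auto
  qed
qed

end

section \<open>The largest solution\<close>

lemma borel_measurable_fst_snd [measurable (raw)]:
  fixes f :: "'a \<Rightarrow> real \<times> real"
  assumes "f \<in> borel_measurable M"
  shows "(\<lambda>x. fst (f x)) \<in> borel_measurable M" "(\<lambda>x. snd (f x)) \<in> borel_measurable M"
  using measurable_compose[OF assms borel_measurable_continuous_onI[of fst]]
    measurable_compose[OF assms borel_measurable_continuous_onI[of snd]]
  by (simp_all add: continuous_on_fst continuous_on_snd continuous_on_id)

lemma set_lborel_integral_const:
  fixes z :: "real \<times> real"
  assumes "0 \<le> fst z" "0 \<le> snd z"
  shows "(LINT p:cbox 0 z|lborel. (c::real)) = c * (fst z * snd z)"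
  using assms by (simp add: set_lebesgue_integral_def measure_cbox_0)

lemma set_integral_box_mono:
  fixes f g :: "real \<times> real \<Rightarrow> real"
  assumes "f \<in> borel_measurable borel" "g \<in> borel_measurable borel"
    and "\<And>p. \<bar>f p\<bar> \<le> B" "\<And>p. \<bar>g p\<bar> \<le> B" "\<And>p. p \<in> cbox 0 z \<Longrightarrow> f p \<le> g p"
  shows "(LINT p:cbox 0 z|lborel. f p) \<le> (LINT p:cbox 0 z|lborel. g p)"
  by (rule set_integral_mono[OF set_integrable_box[OF assms(1,3)] set_integrable_box[OF assms(2,4)] assms(5)])

lemma set_integral_box_bound:
  fixes f :: "real \<times> real \<Rightarrow> real"
  assumes "f \<in> borel_measurable borel" "\<And>p. \<bar>f p\<bar> \<le> B" "0 \<le> fst z" "0 \<le> snd z"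
  shows "(LINT p:cbox 0 z|lborel. f p) \<le> B * (fst z * snd z)"
    and "- B * (fst z * snd z) \<le> (LINT p:cbox 0 z|lborel. f p)"
proof -
  have B: "\<bar>f p\<bar> \<le> \<bar>B\<bar>" for p using assms(2)[of p] by linarith
  have "f p \<le> B" "- B \<le> f p" for p using assms(2)[of p] by linarith+
  then have "(LINT p:cbox 0 z|lborel. f p) \<le> (LINT p:cbox 0 z|lborel. B)"
    "(LINT p:cbox 0 z|lborel. - B) \<le> (LINT p:cbox 0 z|lborel. f p)"
    using set_integral_box_mono[OF assms(1) _ B, of "\<lambda>_. B" z]
      set_integral_box_mono[OF _ assms(1) _ B, of "\<lambda>_. - B" z] by simp_all
  then show "(LINT p:cbox 0 z|lborel. f p) \<le> B * (fst z * snd z)"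
    "- B * (fst z * snd z) \<le> (LINT p:cbox 0 z|lborel. f p)"
    by (simp_all only: set_lborel_integral_const[OF assms(3,4)])
qed

text \<open>Joint measurability in the parameter and the corner is what an iteration requires, since
  the next step integrates over the corner. Later the parameter is the driving path itself.\<close>

lemma borel_measurable_box_integral:
  fixes f :: "'e \<Rightarrow> real \<times> real \<Rightarrow> real ^ 'd"
  assumes [measurable]: "(\<lambda>x. f (fst x) (snd x)) \<in> borel_measurable (N \<Otimes>\<^sub>M borel)"
  shows "(\<lambda>x. box_integral (f (fst x)) (snd x)) \<in> borel_measurable (N \<Otimes>\<^sub>M borel)"
proof (rule borel_measurable_vecI)
  fix i
  have "(\<lambda>x::('e \<times> (real \<times> real)) \<times> (real \<times> real). (fst (fst x), snd x)) \<in> (N \<Otimes>\<^sub>M borel) \<Otimes>\<^sub>M borel \<rightarrow>\<^sub>M N \<Otimes>\<^sub>M borel"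
    by measurable
  from measurable_compose[OF this assms]
  have [measurable]: "(\<lambda>x::('e \<times> (real \<times> real)) \<times> (real \<times> real). f (fst (fst x)) (snd x)) \<in> borel_measurable ((N \<Otimes>\<^sub>M borel) \<Otimes>\<^sub>M borel)"
    by simp
  have "(\<lambda>x. indicat_real (cbox 0 (snd (fst x))) (snd x) *\<^sub>R f (fst (fst x)) (snd x) $ i) =
    (\<lambda>x. if 0 \<le> fst (snd x) \<and> fst (snd x) \<le> fst (snd (fst x)) \<and> 0 \<le> snd (snd x) \<and> snd (snd x) \<le> snd (snd (fst x))
      then f (fst (fst x)) (snd x) $ i else 0)"
    by (auto simp: fun_eq_iff mem_cbox_0 indicator_def)
  also have "\<dots> \<in> borel_measurable ((N \<Otimes>\<^sub>M borel) \<Otimes>\<^sub>M borel)"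
    by measurable
  also have "borel_measurable ((N \<Otimes>\<^sub>M (borel :: (real \<times> real) measure)) \<Otimes>\<^sub>M (borel :: (real \<times> real) measure)) =
      borel_measurable ((N \<Otimes>\<^sub>M borel) \<Otimes>\<^sub>M lborel)"
    by (intro measurable_cong_sets sets_pair_measure_cong) simp_all
  finally have "(\<lambda>x. indicat_real (cbox 0 (snd (fst x))) (snd x) *\<^sub>R f (fst (fst x)) (snd x) $ i)
      \<in> borel_measurable ((N \<Otimes>\<^sub>M borel) \<Otimes>\<^sub>M lborel)" .
  then have "(\<lambda>x. \<integral>p. indicat_real (cbox 0 (snd x)) p *\<^sub>R f (fst x) p $ i \<partial>lborel) \<in> borel_measurable (N \<Otimes>\<^sub>M borel)"
    by (intro lborel.borel_measurable_lebesgue_integral) (simp add: split_beta')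
  then show "(\<lambda>x. box_integral (f (fst x)) (snd x) $ i) \<in> borel_measurable (N \<Otimes>\<^sub>M borel)"
    by (simp add: box_integral_nth set_lebesgue_integral_def)
qed

section \<open>Monotone iteration from above\<close>

context monotone_drift
begin

lemma upper_iter_measurable_param:
  assumes [measurable]: "(\<lambda>x. w (fst x) (snd x)) \<in> borel_measurable (N \<Otimes>\<^sub>M borel)"
  shows "(\<lambda>x. upper_iter \<beta> C (w (fst x)) n (snd x)) \<in> borel_measurable (N \<Otimes>\<^sub>M borel)"
proof (induction n)
  case 0
  show ?case
    by (rule borel_measurable_vecI) simp
next
  case (Suc n)
  note [measurable] = Suc
  interpret u: monotone_drift "upper_drift \<beta>" C by (rule monotone_drift_upper)
  have [measurable]: "(\<lambda>x. box_integral ((\<lambda>e p. upper_drift \<beta> p (upper_iter \<beta> C (w e) n p)) (fst x)) (snd x)) \<in> borel_measurable (N \<Otimes>\<^sub>M borel)"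
    by (rule borel_measurable_box_integral, rule u.drift_comp_measurable) measurable
  show ?case unfolding upper_iter.simps by measurable
qed

lemma upper_sol_measurable_param:
  assumes "(\<lambda>x. w (fst x) (snd x)) \<in> borel_measurable (N \<Otimes>\<^sub>M borel)"
  shows "(\<lambda>x. upper_sol \<beta> C (w (fst x)) (snd x)) \<in> borel_measurable (N \<Otimes>\<^sub>M borel)"
proof (rule borel_measurable_vecI)
  note [measurable] = upper_iter_measurable_param[OF assms]
  show "(\<lambda>x. upper_sol \<beta> C (w (fst x)) (snd x) $ i) \<in> borel_measurable (N \<Otimes>\<^sub>M borel)" for i
    unfolding upper_sol_def vec_lambda_beta by measurable
qed

context
  fixes w :: "real \<times> real \<Rightarrow> real ^ 'd"
  assumes w_measurable [measurable]: "w \<in> borel_measurable borel"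
begin

lemma upper_iter_measurable [measurable]: "upper_iter \<beta> C w n \<in> borel_measurable borel"
proof -
  \<comment> \<open>A fixed path is treated as a family over a one-point parameter space.\<close>
  have *: "(\<lambda>x::unit \<times> (real \<times> real). upper_iter \<beta> C w n (snd x)) \<in> borel_measurable (count_space UNIV \<Otimes>\<^sub>M borel)"
    by (rule upper_iter_measurable_param) simp
  have "(\<lambda>p. ((), p)) \<in> borel \<rightarrow>\<^sub>M count_space UNIV \<Otimes>\<^sub>M borel" by measurable
  from measurable_compose[OF this *] show ?thesis by simp
qed

lemma upper_sol_measurable [measurable]: "upper_sol \<beta> C w \<in> borel_measurable borel"
  by (rule borel_measurable_vecI) (simp add: upper_sol_def)

lemma upper_drift_iter_measurable [measurable]:
  "(\<lambda>p. upper_drift \<beta> p (upper_iter \<beta> C w n p)) \<in> borel_measurable borel"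
  by (rule monotone_drift.drift_comp_measurable[OF monotone_drift_upper]) measurable

lemma upper_drift_sol_measurable [measurable]:
  "(\<lambda>p. upper_drift \<beta> p (upper_sol \<beta> C w p)) \<in> borel_measurable borel"
  by (rule monotone_drift.drift_comp_measurable[OF monotone_drift_upper]) measurable

lemma upper_iter_ge:
  assumes "0 \<le> fst z" "0 \<le> snd z"
  shows "w z $ i - C * (fst z * snd z) \<le> upper_iter \<beta> C w n z $ i"
proof (cases n)
  case 0
  then show ?thesis using assms C_nonneg by simp
next
  case (Suc m)
  then show ?thesis
    using set_integral_box_bound(2)[of "\<lambda>p. upper_drift \<beta> p (upper_iter \<beta> C w m p) $ i" C z] assms
      monotone_drift.drift_bound[OF monotone_drift_upper]
    by (simp add: box_integral_nth)
qed

lemma upper_iter_decreasing: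
  assumes "0 \<le> fst z" "0 \<le> snd z"
  shows "upper_iter \<beta> C w (Suc n) z $ i \<le> upper_iter \<beta> C w n z $ i"
  using assms
proof (induction n arbitrary: z i)
  case 0
  have [measurable]: "(\<lambda>p. upper_drift \<beta> p (upper_iter \<beta> C w 0 p) $ i) \<in> borel_measurable borel"
    by (intro borel_measurable_vec_nth upper_drift_iter_measurable)
  from set_integral_box_bound(1)[OF this monotone_drift.drift_bound[OF monotone_drift_upper] 0]
  show ?case by (simp add: box_integral_nth)
next
  case (Suc n)
  have "(LINT p:cbox 0 z|lborel. upper_drift \<beta> p (upper_iter \<beta> C w (Suc n) p) $ i)
    \<le> (LINT p:cbox 0 z|lborel. upper_drift \<beta> p (upper_iter \<beta> C w n p) $ i)"
  proof (rule set_integral_box_mono[where B=C])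
    fix p assume "p \<in> cbox 0 z"
    then show "upper_drift \<beta> p (upper_iter \<beta> C w (Suc n) p) $ i \<le> upper_drift \<beta> p (upper_iter \<beta> C w n p) $ i"
      by (intro monotone_drift.drift_mono[OF monotone_drift_upper] Suc.IH) (auto simp: mem_cbox_0)
  qed (intro monotone_drift.drift_bound[OF monotone_drift_upper] borel_measurable_vec_nth upper_drift_iter_measurable)+
  then show ?case
    by (subst (1 2) upper_iter.simps(2)) (simp add: box_integral_nth del: upper_iter.simps)
qed

lemma upper_iter_tendsto:
  assumes "0 \<le> fst z" "0 \<le> snd z"
  shows "(\<lambda>n. upper_iter \<beta> C w n z $ i) \<longlonglongrightarrow> upper_sol \<beta> C w z $ i"
    and "upper_sol \<beta> C w z $ i \<le> upper_iter \<beta> C w n z $ i"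
proof -
  have "decseq (\<lambda>n. upper_iter \<beta> C w n z $ i)"
    by (intro decseq_SucI upper_iter_decreasing assms)
  then obtain L where L: "(\<lambda>n. upper_iter \<beta> C w n z $ i) \<longlonglongrightarrow> L" "\<And>n. L \<le> upper_iter \<beta> C w n z $ i"
    using decseq_convergent[of "\<lambda>n. upper_iter \<beta> C w n z $ i"] upper_iter_ge[OF assms] by metis
  moreover have "upper_sol \<beta> C w z $ i = L"
    using L(1) by (simp add: upper_sol_def limI)
  ultimately show "(\<lambda>n. upper_iter \<beta> C w n z $ i) \<longlonglongrightarrow> upper_sol \<beta> C w z $ i"
    "upper_sol \<beta> C w z $ i \<le> upper_iter \<beta> C w n z $ i" by auto
qed

text \<open>The limit passes under the integral because the iterates decrease, and from above the
  regularised drift is continuous; for \<open>\<beta>\<close> itself this step could fail.\<close>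

lemma upper_sol_eq:
  assumes "0 \<le> fst z" "0 \<le> snd z"
  shows "upper_sol \<beta> C w z = box_integral (\<lambda>p. upper_drift \<beta> p (upper_sol \<beta> C w p)) z + w z"
proof (rule vec_eq_iff[THEN iffD2], rule allI)
  fix i
  interpret u: monotone_drift "upper_drift \<beta>" C by (rule monotone_drift_upper)
  have "(\<lambda>n. LINT p:cbox 0 z|lborel. upper_drift \<beta> p (upper_iter \<beta> C w n p) $ i)
    \<longlonglongrightarrow> (LINT p:cbox 0 z|lborel. upper_drift \<beta> p (upper_sol \<beta> C w p) $ i)"
    unfolding set_lebesgue_integral_def
  proof (rule integral_dominated_convergence)
    show "integrable lborel (\<lambda>p::real \<times> real. indicator (cbox 0 z) p *\<^sub>R C)"
      using set_integrable_box[of "\<lambda>_. C" "\<bar>C\<bar>" 0 z] by (simp add: set_integrable_def)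
    show "AE p in lborel. norm (indicat_real (cbox 0 z) p *\<^sub>R upper_drift \<beta> p (upper_iter \<beta> C w n p) $ i)
        \<le> indicator (cbox 0 z) p *\<^sub>R C" for n
      using u.drift_bound by (intro AE_I2) (simp add: indicator_def)
    show "AE p in lborel. (\<lambda>n. indicat_real (cbox 0 z) p *\<^sub>R upper_drift \<beta> p (upper_iter \<beta> C w n p) $ i)
        \<longlonglongrightarrow> indicator (cbox 0 z) p *\<^sub>R upper_drift \<beta> p (upper_sol \<beta> C w p) $ i"
    proof (rule AE_I2)
      fix p :: "real \<times> real"
      show "(\<lambda>n. indicat_real (cbox 0 z) p *\<^sub>R upper_drift \<beta> p (upper_iter \<beta> C w n p) $ i)
        \<longlonglongrightarrow> indicator (cbox 0 z) p *\<^sub>R upper_drift \<beta> p (upper_sol \<beta> C w p) $ i"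
      proof (cases "p \<in> cbox 0 z")
        case True
        then have "0 \<le> fst p" "0 \<le> snd p" by (auto simp: mem_cbox_0)
        from upper_iter_tendsto[OF this] True show ?thesis
          by (simp add: upper_drift_right_continuous)
      qed simp
    qed
  qed simp_all
  then have "(\<lambda>n. upper_iter \<beta> C w (Suc n) z $ i) \<longlonglongrightarrow>
     (LINT p:cbox 0 z|lborel. upper_drift \<beta> p (upper_sol \<beta> C w p) $ i) + w z $ i"
    by (simp add: box_integral_nth tendsto_add)
  moreover have "(\<lambda>n. upper_iter \<beta> C w (Suc n) z $ i) \<longlonglongrightarrow> upper_sol \<beta> C w z $ i"
    by (rule LIMSEQ_Suc[OF upper_iter_tendsto(1)[OF assms]])
  ultimately show "upper_sol \<beta> C w z $ i = (box_integral (\<lambda>p. upper_drift \<beta> p (upper_sol \<beta> C w p)) z + w z) $ i"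
    unfolding vector_add_component box_integral_nth by (rule LIMSEQ_unique[rotated])
qed

text \<open>By induction \<open>Y\<close> stays below every iterate, starting from
  \<open>g \<le> C\<close>. Carrying a separate density \<open>g\<close>, only bounded by the
  regularised drift, makes the lemma serve both solutions for \<open>\<beta>\<close> and
  \<open>lower_sol\<close>; \<open>Y\<close> itself need not be measurable.\<close>

lemma le_upper_sol:
  assumes [measurable]: "g \<in> borel_measurable borel" and g: "\<And>p i. \<bar>g p $ i\<bar> \<le> C"
    and g_le: "\<And>p i. p \<in> unit_sq \<Longrightarrow> g p $ i \<le> upper_drift \<beta> p (Y p) $ i"
    and Y: "\<And>z. z \<in> unit_sq \<Longrightarrow> Y z = box_integral g z + w z"
    and z: "z \<in> unit_sq"
  shows "Y z $ i \<le> upper_sol \<beta> C w z $ i"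
proof (rule LIMSEQ_le_const[OF upper_iter_tendsto(1)])
  show "0 \<le> fst z" "0 \<le> snd z" using z by (auto simp: unit_sq_def)
  interpret u: monotone_drift "upper_drift \<beta>" C by (rule monotone_drift_upper)
  have "Y z $ i \<le> upper_iter \<beta> C w n z $ i" for n
    using z
  proof (induction n arbitrary: z i)
    case 0
    have "0 \<le> fst z" "0 \<le> snd z" using 0 by (auto simp: unit_sq_def)
    then show ?case using set_integral_box_bound(1)[of "\<lambda>p. g p $ i" C z] g 0
      by (simp add: Y box_integral_nth)
  next
    case (Suc n)
    have "(LINT p:cbox 0 z|lborel. g p $ i) \<le> (LINT p:cbox 0 z|lborel. upper_drift \<beta> p (upper_iter \<beta> C w n p) $ i)"
    proof (rule set_integral_box_mono[where B=C])
      fix p assume "p \<in> cbox 0 z"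
      then have p: "p \<in> unit_sq" using Suc.prems by (auto simp: mem_cbox_0 unit_sq_def mem_Times_iff)
      have "g p $ i \<le> upper_drift \<beta> p (Y p) $ i" by (rule g_le[OF p])
      also have "\<dots> \<le> upper_drift \<beta> p (upper_iter \<beta> C w n p) $ i"
        by (intro u.drift_mono Suc.IH p)
      finally show "g p $ i \<le> upper_drift \<beta> p (upper_iter \<beta> C w n p) $ i" .
    qed (simp_all add: g u.drift_bound)
    then show ?case using Suc.prems by (simp add: Y box_integral_nth)
  qed
  then show "\<exists>N. \<forall>n\<ge>N. Y z $ i \<le> upper_iter \<beta> C w n z $ i" by auto
qed

end

end

section \<open>The smallest solution and the comparison principle\<close>

text \<open>This is the left-continuous regularisation, the supremum of \<open>\<beta>\<close> over
  diagonal shifts downwards.\<close>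

definition lower_drift :: "(real \<times> real \<Rightarrow> real ^ 'd \<Rightarrow> real ^ 'd) \<Rightarrow> real \<times> real \<Rightarrow> real ^ 'd \<Rightarrow> real ^ 'd" where
  "lower_drift \<beta> = reflect_drift (upper_drift (reflect_drift \<beta>))"

text \<open>The area of the part of the rectangle below \<open>z\<close> that lies in the L-shaped strip
  \<open>{p. fst p < r \<or> snd p < r}\<close> along the axes.\<close>

definition strip_area :: "real \<Rightarrow> real \<times> real \<Rightarrow> real" where
  "strip_area r z = fst z * snd z - max (fst z - r) 0 * max (snd z - r) 0"

lemma strip_area_pos:
  assumes "0 < r" "0 < fst z" "0 < snd z"
  shows "0 < strip_area r z"
proof -
  have "max (fst z - r) 0 * max (snd z - r) 0 \<le> max (fst z - r) 0 * snd z"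
    using assms by (intro mult_left_mono) auto
  also have "\<dots> < fst z * snd z"
    using assms by (intro mult_strict_right_mono) auto
  finally show ?thesis by (simp add: strip_area_def)
qed

lemma strip_area_axis: "0 < r \<Longrightarrow> fst z = 0 \<or> snd z = 0 \<Longrightarrow> strip_area r z = 0"
  by (auto simp: strip_area_def)

lemma continuous_on_strip_area: "continuous_on S (strip_area r)"
  unfolding strip_area_def by (intro continuous_intros)

lemma box_integral_uminus: "box_integral (\<lambda>p. - f p) z = - box_integral f z"
  by (simp add: vec_eq_iff box_integral_nth set_lebesgue_integral_def)

text \<open>The box from \<open>(r, r)\<close> to \<open>z\<close> is, up to a null set, what the
  rectangle below \<open>z\<close> has outside the strip, so \<open>strip_area\<close> is a
  difference of two box measures. The maxima cover the empty box.\<close>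

lemma measure_cbox_diagonal:
  fixes z :: "real \<times> real"
  shows "measure lborel (cbox (r, r) z) = max (fst z - r) 0 * max (snd z - r) 0"
proof (cases "r \<le> fst z \<and> r \<le> snd z")
  case True
  then show ?thesis by (cases z) (simp add: content_Pair max_def)
next
  case False
  then have "cbox (r, r) z = {}"
    by (cases z) (auto simp: cbox_Pair_eq)
  then show ?thesis using False by auto
qed

section \<open>Ordering of the two extremal solutions\<close>

context monotone_drift
begin

lemma lower_drift_le: "lower_drift \<beta> z x $ i \<le> \<beta> z x $ i"
  using monotone_drift.le_upper_drift[OF monotone_drift_reflect, of z "- x" i]
  by (simp add: lower_drift_def reflect_drift_def)

lemma le_lower_drift_strict:
  assumes "\<And>j. y $ j < x $ j"
  shows "\<beta> z y $ i \<le> lower_drift \<beta> z x $ i"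
  using monotone_drift.upper_drift_le_strict[OF monotone_drift_reflect, of "- x" "- y" z i] assms
  by (simp add: lower_drift_def reflect_drift_def)

lemma monotone_drift_lower: "monotone_drift (lower_drift \<beta>) C"
  unfolding lower_drift_def
  by (intro monotone_drift.monotone_drift_reflect monotone_drift.monotone_drift_upper monotone_drift_axioms)

text \<open>The value of \<open>\<beta>\<close> at the midpoint separates the two regularisations.
  This needs strict order in every coordinate, which is why the comparison argument below works with
  strict inequalities.\<close>

lemma upper_drift_le_lower_drift:
  assumes "\<And>j. x $ j < y $ j"
  shows "upper_drift \<beta> z x $ i \<le> lower_drift \<beta> z y $ i"
proof -
  define m where "m = (1 / 2) *\<^sub>R (x + y)"
  have "x $ j < m $ j" "m $ j < y $ j" for j
    using assms[of j] by (auto simp: m_def)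
  then have "upper_drift \<beta> z x $ i \<le> \<beta> z m $ i" "\<beta> z m $ i \<le> lower_drift \<beta> z y $ i"
    by (auto intro: upper_drift_le_strict le_lower_drift_strict)
  then show ?thesis by linarith
qed

lemma lower_sol_measurable:
  assumes [measurable]: "w \<in> borel_measurable borel"
  shows "lower_sol \<beta> C w \<in> borel_measurable borel"
proof -
  have "upper_sol (reflect_drift \<beta>) C (\<lambda>z. - w z) \<in> borel_measurable borel"
    by (rule monotone_drift.upper_sol_measurable[OF monotone_drift_reflect]) simp
  then show ?thesis unfolding lower_sol_def[abs_def] by simp
qed

lemma lower_sol_measurable_param:
  assumes [measurable]: "(\<lambda>x. w (fst x) (snd x)) \<in> borel_measurable (N \<Otimes>\<^sub>M borel)"
  shows "(\<lambda>x. lower_sol \<beta> C (w (fst x)) (snd x)) \<in> borel_measurable (N \<Otimes>\<^sub>M borel)"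
proof -
  have "(\<lambda>x. upper_sol (reflect_drift \<beta>) C ((\<lambda>e z. - w e z) (fst x)) (snd x)) \<in> borel_measurable (N \<Otimes>\<^sub>M borel)"
    by (rule monotone_drift.upper_sol_measurable_param[OF monotone_drift_reflect]) simp
  then show ?thesis unfolding lower_sol_def by simp
qed

lemma lower_sol_eq:
  assumes "w \<in> borel_measurable borel" "0 \<le> fst z" "0 \<le> snd z"
  shows "lower_sol \<beta> C w z = box_integral (\<lambda>p. lower_drift \<beta> p (lower_sol \<beta> C w p)) z + w z"
  using monotone_drift.upper_sol_eq[OF monotone_drift_reflect _ assms(2,3), of "\<lambda>z. - w z"] assms(1)
  by (simp add: lower_sol_def lower_drift_def reflect_drift_def[of "upper_drift _"] box_integral_uminus)

lemma lower_sol_le: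
  assumes w: "w \<in> borel_measurable borel"
    and g: "g \<in> borel_measurable borel" "\<And>p i. \<bar>g p $ i\<bar> \<le> C"
    and g_ge: "\<And>p i. p \<in> unit_sq \<Longrightarrow> lower_drift \<beta> p (Y p) $ i \<le> g p $ i"
    and Y: "\<And>z. z \<in> unit_sq \<Longrightarrow> Y z = box_integral g z + w z"
    and z: "z \<in> unit_sq"
  shows "lower_sol \<beta> C w z $ i \<le> Y z $ i"
proof -
  have "(- Y z) $ i \<le> upper_sol (reflect_drift \<beta>) C (\<lambda>z. - w z) z $ i"
  proof (rule monotone_drift.le_upper_sol[OF monotone_drift_reflect _ _ _ _ _ z])
    show "(\<lambda>p. - g p) \<in> borel_measurable borel" "(\<lambda>z. - w z) \<in> borel_measurable borel"
      using g w by simp_all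
    show "\<bar>(- g p) $ i\<bar> \<le> C" for p i using g by simp
    show "(- g p) $ i \<le> upper_drift (reflect_drift \<beta>) p (- Y p) $ i" if "p \<in> unit_sq" for p i
      using g_ge[OF that, of i] by (simp add: lower_drift_def reflect_drift_def[of "upper_drift _"])
    show "- Y z = box_integral (\<lambda>p. - g p) z + - w z" if "z \<in> unit_sq" for z
      using Y[OF that] by (simp add: box_integral_uminus)
  qed
  then show ?thesis by (simp add: lower_sol_def)
qed

text \<open>The smallest solution is itself a competitor in \<open>le_upper_sol\<close>, with its
  own regularised drift as density.\<close>

lemma lower_sol_le_upper_sol:
  assumes w [measurable]: "w \<in> borel_measurable borel" and z: "z \<in> unit_sq"
  shows "lower_sol \<beta> C w z $ i \<le> upper_sol \<beta> C w z $ i"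
proof (rule le_upper_sol[OF w _ _ _ _ z])
  note [measurable] = lower_sol_measurable[OF w]
  show "(\<lambda>p. lower_drift \<beta> p (lower_sol \<beta> C w p)) \<in> borel_measurable borel"
    by (rule monotone_drift.drift_comp_measurable[OF monotone_drift_lower]) measurable
  show "\<bar>lower_drift \<beta> p (lower_sol \<beta> C w p) $ i\<bar> \<le> C" for p i
    by (rule monotone_drift.drift_bound[OF monotone_drift_lower])
  show "lower_drift \<beta> p (lower_sol \<beta> C w p) $ i \<le> upper_drift \<beta> p (lower_sol \<beta> C w p) $ i" for p i
    using lower_drift_le le_upper_drift by (rule order_trans)
  show "lower_sol \<beta> C w z = box_integral (\<lambda>p. lower_drift \<beta> p (lower_sol \<beta> C w p)) z + w z" if "z \<in> unit_sq" for z
    using that by (intro lower_sol_eq w) (auto simp: unit_sq_def)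
qed

text \<open>A push of size \<open>3 * C\<close> inside the strip beats the drift difference, which is at least
  \<open>- 2 * C\<close>; beyond the strip the two solutions are already strictly ordered, and then
  monotonicity makes the drift difference nonnegative.\<close>

lemma upper_sol_le_lower_sol_shift:
  assumes C: "0 < C" and r: "0 < r"
    and w [measurable]: "w \<in> borel_measurable borel" "w' \<in> borel_measurable borel"
    and shift: "\<And>z. z \<in> unit_sq \<Longrightarrow> w' z = w z + vec (3 * C * strip_area r z)"
    and z0: "z0 \<in> unit_sq"
  shows "upper_sol \<beta> C w z0 $ i0 \<le> lower_sol \<beta> C w' z0 $ i0"
proof -
  define U where "U = upper_sol \<beta> C w"
  define L where "L = lower_sol \<beta> C w'"
  define F where "F i p = lower_drift \<beta> p (L p) $ i - upper_drift \<beta> p (U p) $ i" for i p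
  define D where "D i z = L z $ i - U z $ i" for i z
  interpret l: monotone_drift "lower_drift \<beta>" C by (rule monotone_drift_lower)
  interpret u: monotone_drift "upper_drift \<beta>" C by (rule monotone_drift_upper)
  have [measurable]: "U \<in> borel_measurable borel" "L \<in> borel_measurable borel"
    unfolding U_def L_def by (simp_all add: lower_sol_measurable upper_sol_measurable)
  have [measurable]: "(\<lambda>p. lower_drift \<beta> p (L p)) \<in> borel_measurable borel"
    "(\<lambda>p. upper_drift \<beta> p (U p)) \<in> borel_measurable borel"
    by (rule l.drift_comp_measurable u.drift_comp_measurable; measurable)+
  have F_meas [measurable]: "F i \<in> borel_measurable borel" for i
    unfolding F_def by measurable
  have F_ge: "- (2 * C) \<le> F i p" for i p
    unfolding F_def using l.drift_ge[of p "L p" i] u.drift_le[of p "U p" i] by linarith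
  have F_bound: "\<bar>F i p\<bar> \<le> 2 * C" for i p
    unfolding F_def using l.drift_ge[of p "L p" i] u.drift_le[of p "U p" i]
      l.drift_le[of p "L p" i] u.drift_ge[of p "U p" i] by linarith
  have D_eq: "D i z = (LINT p:cbox 0 z|lborel. F i p) + 3 * C * strip_area r z" if z: "z \<in> unit_sq" for i z
  proof -
    have nn: "0 \<le> fst z" "0 \<le> snd z" using z by (auto simp: unit_sq_def)
    have "L z $ i = (LINT p:cbox 0 z|lborel. lower_drift \<beta> p (L p) $ i) + w' z $ i"
      unfolding L_def by (subst lower_sol_eq[OF w(2) nn]) (simp add: box_integral_nth)
    moreover have "U z $ i = (LINT p:cbox 0 z|lborel. upper_drift \<beta> p (U p) $ i) + w z $ i"
      unfolding U_def by (subst upper_sol_eq[OF w(1) nn]) (simp add: box_integral_nth)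
    moreover have "(LINT p:cbox 0 z|lborel. F i p) =
        (LINT p:cbox 0 z|lborel. lower_drift \<beta> p (L p) $ i) - (LINT p:cbox 0 z|lborel. upper_drift \<beta> p (U p) $ i)"
      unfolding F_def
      by (rule set_integral_diff(2)) (auto intro!: set_integrable_box[where B=C] l.drift_bound u.drift_bound)
    ultimately show ?thesis by (simp add: D_def shift[OF z])
  qed
  have D_cont: "continuous_on unit_sq (D i)" for i
  proof -
    have "continuous_on unit_sq (\<lambda>z. (LINT p:cbox 0 z|lborel. F i p) + 3 * C * strip_area r z)"
      by (intro continuous_intros continuous_box_integral[where B="2*C"] F_meas F_bound continuous_on_strip_area)
    then show ?thesis by (rule continuous_on_eq) (simp add: D_eq)
  qed
  have key: "0 < D i z" if z: "z \<in> unit_sq" "0 < fst z" "0 < snd z"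
    and before: "\<And>p j. p \<in> cbox (r, r) z \<Longrightarrow> p \<noteq> z \<Longrightarrow> 0 < D j p" for i z
  proof -
    \<comment> \<open>\<open>?h\<close> bounds the integrand below for almost every point:
      \<open>- 2 * C\<close> on the strip, \<open>0\<close> beyond it. The corner \<open>z\<close>
      must be left out, as the order there is the claim, but it is a null set. Against the push of
      \<open>3 * C\<close> a surplus of \<open>C * strip_area r z\<close> remains.\<close>
    let ?h = "\<lambda>p. - (2 * C) * indicat_real (cbox 0 z) p + 2 * C * indicat_real (cbox (r, r) z) p"
    have sub: "p \<in> cbox (r, r) z \<Longrightarrow> p \<in> cbox 0 z" for p
      using r by (cases z; cases p) (auto simp: cbox_Pair_eq zero_prod_def)
    have "integrable lborel (indicat_real (cbox 0 z))" "integrable lborel (indicat_real (cbox (r, r) z))"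
      by (auto intro!: integrable_real_indicator simp: emeasure_lborel_cbox_eq)
    then have int: "integrable lborel ?h" and
      "integral\<^sup>L lborel ?h = - (2 * C) * measure lborel (cbox 0 z) + 2 * C * measure lborel (cbox (r, r) z)"
      by simp_all
    then have h: "integral\<^sup>L lborel ?h = - (2 * C) * strip_area r z"
      using z by (simp add: measure_cbox_0 measure_cbox_diagonal strip_area_def algebra_simps)
    have "integral\<^sup>L lborel ?h \<le> (LINT p:cbox 0 z|lborel. F i p)"
      unfolding set_lebesgue_integral_def
    proof (rule integral_mono_AE[OF int])
      show "integrable lborel (\<lambda>p. indicat_real (cbox 0 z) p *\<^sub>R F i p)"
        using set_integrable_box[OF F_meas F_bound, of 0 z i] by (simp add: set_integrable_def)
      have "AE p in lborel. p \<noteq> z"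
        by (rule AE_lborel_singleton)
      then show "AE p in lborel. ?h p \<le> indicat_real (cbox 0 z) p *\<^sub>R F i p"
      proof eventually_elim
        case (elim p)
        show ?case
        proof (cases "p \<in> cbox (r, r) z")
          case True
          then have "L p $ j > U p $ j" for j using before[OF True elim, of j] by (simp add: D_def)
          then have "0 \<le> F i p" unfolding F_def using upper_drift_le_lower_drift by simp
          then show ?thesis using True sub by (simp add: indicator_def)
        next
          case False
          then show ?thesis using F_ge[of i p] by (simp add: indicator_def)
        qed
      qed
    qed
    moreover have "0 < C * strip_area r z" using strip_area_pos[OF r] z C by simp
    ultimately show ?thesis using D_eq[OF z(1), of i] h by linarith
  qed
  define K where "K = cbox (r, r) (1::real, 1::real)"
  have K_sub: "K \<subseteq> unit_sq" using r by (auto simp: K_def unit_sq_def cbox_Pair_eq)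
  have pos_K: "0 < D i z" if "z \<in> K" for i z
  proof (rule ccontr)
    assume "\<not> 0 < D i z"
    \<comment> \<open>First failure argument: the points of \<open>K\<close> where some component is
      not strictly ordered form a compact set, and one that minimises the coordinate sum has only
      strictly ordered points before it, contradicting \<open>key\<close>.\<close>
    define Bad where "Bad = (\<Union>i. {z \<in> K. D i z \<le> 0})"
    have "compact {z \<in> K. D i z \<le> 0}" for i
    proof -
      have "closed {z \<in> K. D i z \<le> 0}"
        using continuous_on_subset[OF D_cont K_sub]
        by (intro continuous_on_closed_Collect_le continuous_on_const) (auto simp: K_def)
      moreover have "bounded {z \<in> K. D i z \<le> 0}"
        by (rule bounded_subset[of K]) (auto simp: K_def)
      ultimately show ?thesis by (simp add: compact_eq_bounded_closed)
    qed
    then have "compact Bad" unfolding Bad_def by (intro compact_UN) auto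
    moreover have "z \<in> Bad" using \<open>\<not> 0 < D i z\<close> that by (auto simp: Bad_def not_less)
    moreover have "continuous_on Bad (\<lambda>z. fst z + snd z)" by (intro continuous_intros)
    ultimately obtain y where y: "y \<in> Bad" and y_min: "\<And>p. p \<in> Bad \<Longrightarrow> fst y + snd y \<le> fst p + snd p"
      using continuous_attains_inf[of Bad "\<lambda>z. fst z + snd z"] by blast
    from y obtain j where j: "y \<in> K" "D j y \<le> 0" by (auto simp: Bad_def)
    then have yk: "r \<le> fst y" "r \<le> snd y" "fst y \<le> 1" "snd y \<le> 1"
      by (cases y; auto simp: K_def cbox_Pair_eq)+
    have "0 < D j y"
    proof (rule key)
      show "y \<in> unit_sq" using j(1) K_sub by auto
      show "0 < fst y" "0 < snd y" using yk r by auto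
      fix p k assume p: "p \<in> cbox (r, r) y" "p \<noteq> y"
      then have "p \<in> K" "fst p + snd p < fst y + snd y"
        using yk by (cases p; cases y; auto simp: K_def cbox_Pair_eq)+
      then show "0 < D k p" using y_min[of p] by (force simp: Bad_def not_less[symmetric])
    qed
    then show False using j by simp
  qed
  have "0 \<le> D i0 z0"
  \<comment> \<open>On the axes both the integral and the push vanish, so only the weak inequality
    survives there.\<close>
  proof (cases "fst z0 = 0 \<or> snd z0 = 0")
    case True
    have "(LINT p:cbox 0 z0|lborel. F i0 p) \<ge> - (2*C) * (fst z0 * snd z0)"
      using z0 by (intro set_integral_box_bound(2) F_meas F_bound) (auto simp: unit_sq_def)
    then show ?thesis using True D_eq[OF z0, of i0] strip_area_axis[OF r True] by auto
  next
    case False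
    then have "0 < fst z0" "0 < snd z0" using z0 by (auto simp: unit_sq_def)
    have "0 < D i0 z0"
    proof (rule key[OF z0 \<open>0 < fst z0\<close> \<open>0 < snd z0\<close>])
      fix p j assume "p \<in> cbox (r, r) z0"
      then have "p \<in> K" using z0 by (cases p; cases z0; auto simp: K_def cbox_Pair_eq unit_sq_def)
      then show "0 < D j p" by (rule pos_K)
    qed
    then show ?thesis by simp
  qed
  then show ?thesis by (simp add: D_def U_def L_def)
qed

text \<open>When the two extremal solutions agree, the common value also solves the unregularised
  equation, because its drift is squeezed between the two regularised ones.\<close>

lemma unique_solution_of_upper_eq_lower:
  assumes w [measurable]: "w \<in> borel_measurable borel"
    and eq: "\<And>z. z \<in> unit_sq \<Longrightarrow> upper_sol \<beta> C w z = lower_sol \<beta> C w z"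
  shows "\<And>z. z \<in> unit_sq \<Longrightarrow> upper_sol \<beta> C w z = box_integral (\<lambda>p. \<beta> p (upper_sol \<beta> C w p)) z + w z"
    and "\<And>Y z. (\<lambda>p. \<beta> p (Y p)) \<in> borel_measurable borel \<Longrightarrow>
      (\<And>z. z \<in> unit_sq \<Longrightarrow> Y z = box_integral (\<lambda>p. \<beta> p (Y p)) z + w z) \<Longrightarrow>
      z \<in> unit_sq \<Longrightarrow> Y z = upper_sol \<beta> C w z"
proof -
  interpret l: monotone_drift "lower_drift \<beta>" C by (rule monotone_drift_lower)
  interpret u: monotone_drift "upper_drift \<beta>" C by (rule monotone_drift_upper)
  define U where "U = upper_sol \<beta> C w"
  have [measurable]: "U \<in> borel_measurable borel"
    unfolding U_def by (simp add: upper_sol_measurable)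
  have [measurable]: "(\<lambda>p. lower_drift \<beta> p (U p)) \<in> borel_measurable borel"
    "(\<lambda>p. upper_drift \<beta> p (U p)) \<in> borel_measurable borel" "(\<lambda>p. \<beta> p (U p)) \<in> borel_measurable borel"
    by (rule l.drift_comp_measurable u.drift_comp_measurable drift_comp_measurable; measurable)+
  show "upper_sol \<beta> C w z = box_integral (\<lambda>p. \<beta> p (upper_sol \<beta> C w p)) z + w z" if z: "z \<in> unit_sq" for z
    unfolding U_def[symmetric]
  proof (rule vec_eq_iff[THEN iffD2], rule allI)
    fix i
    have nn: "0 \<le> fst z" "0 \<le> snd z" using z by (auto simp: unit_sq_def)
    have sub: "p \<in> cbox 0 z \<Longrightarrow> p \<in> unit_sq" for p
      using z by (auto simp: mem_cbox_0 unit_sq_def mem_Times_iff)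
    have up: "U z = box_integral (\<lambda>p. upper_drift \<beta> p (U p)) z + w z"
      unfolding U_def by (rule upper_sol_eq[OF w nn])
    have lo: "U z = box_integral (\<lambda>p. lower_drift \<beta> p (U p)) z + w z"
    proof -
      have "U z = box_integral (\<lambda>p. lower_drift \<beta> p (lower_sol \<beta> C w p)) z + w z"
        unfolding U_def eq[OF z] by (rule lower_sol_eq[OF w nn])
      also have "box_integral (\<lambda>p. lower_drift \<beta> p (lower_sol \<beta> C w p)) z = box_integral (\<lambda>p. lower_drift \<beta> p (U p)) z"
        by (rule box_integral_cong) (simp add: U_def eq sub)
      finally show ?thesis .
    qed
    have "(LINT p:cbox 0 z|lborel. \<beta> p (U p) $ i) \<le> (LINT p:cbox 0 z|lborel. upper_drift \<beta> p (U p) $ i)"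
      by (rule set_integral_box_mono[where B=C]) (simp_all add: drift_bound u.drift_bound le_upper_drift)
    moreover have "(LINT p:cbox 0 z|lborel. lower_drift \<beta> p (U p) $ i) \<le> (LINT p:cbox 0 z|lborel. \<beta> p (U p) $ i)"
      by (rule set_integral_box_mono[where B=C]) (simp_all add: drift_bound l.drift_bound lower_drift_le)
    ultimately have "(LINT p:cbox 0 z|lborel. \<beta> p (U p) $ i) = U z $ i - w z $ i"
      using arg_cong[OF up, of "\<lambda>v. v $ i"] arg_cong[OF lo, of "\<lambda>v. v $ i"] by (simp add: box_integral_nth)
    then show "U z $ i = (box_integral (\<lambda>p. \<beta> p (U p)) z + w z) $ i"
      by (simp add: box_integral_nth)
  qed
  show "Y z = upper_sol \<beta> C w z"
    if [measurable]: "(\<lambda>p. \<beta> p (Y p)) \<in> borel_measurable borel"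
      and Y: "\<And>z. z \<in> unit_sq \<Longrightarrow> Y z = box_integral (\<lambda>p. \<beta> p (Y p)) z + w z"
      and z: "z \<in> unit_sq" for Y z
  proof (rule vec_eq_iff[THEN iffD2], rule allI)
    fix i
    have "Y z $ i \<le> upper_sol \<beta> C w z $ i"
      by (rule le_upper_sol[OF w _ _ _ Y z]) (simp_all add: drift_bound le_upper_drift)
    moreover have "lower_sol \<beta> C w z $ i \<le> Y z $ i"
      by (rule lower_sol_le[OF w _ _ _ Y z]) (simp_all add: drift_bound lower_drift_le)
    ultimately show "Y z $ i = upper_sol \<beta> C w z $ i" using eq[OF z] by simp
  qed
qed

end

section \<open>Dyadic points, Gaussian shifts and sequential independence\<close>

definition dyadic_grid :: "nat \<Rightarrow> (real \<times> real) set" where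
  "dyadic_grid m = (\<lambda>(a, b). (real a / 2 ^ m, real b / 2 ^ m)) ` ({..2 ^ m} \<times> {..2 ^ m})"

definition dyadic_points :: "(real \<times> real) set" where
  "dyadic_points = (\<Union>m. dyadic_grid m)"

text \<open>The clamp to the unit interval makes every real argument yield an index of the level
  \<open>n\<close> grid.\<close>

definition dyadic_floor :: "nat \<Rightarrow> real \<Rightarrow> nat" where
  "dyadic_floor n s = nat \<lfloor>2 ^ n * max 0 (min 1 s)\<rfloor>"

text \<open>A continuous path is rebuilt from countably many values, so that functionals of paths
  become measurable functions on a countable product, where laws can be compared on cylinder
  sets.\<close>

definition dyadic_extend :: "(real \<times> real \<Rightarrow> real ^ 'd) \<Rightarrow> real \<times> real \<Rightarrow> real ^ 'd" where
  "dyadic_extend e z = lim (\<lambda>n. e (real (dyadic_floor n (fst z)) / 2 ^ n, real (dyadic_floor n (snd z)) / 2 ^ n))"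

lemma dyadic_grid_subset: "dyadic_grid m \<subseteq> unit_sq"
proof -
  have "real a \<le> 2 ^ m" if "a \<le> 2 ^ m" for a
    using that by (metis of_nat_le_iff of_nat_numeral of_nat_power)
  then show ?thesis by (auto simp: dyadic_grid_def unit_sq_def)
qed

lemma dyadic_points_subset: "dyadic_points \<subseteq> unit_sq"
  using dyadic_grid_subset by (auto simp: dyadic_points_def)

lemma countable_dyadic_points: "countable dyadic_points"
  unfolding dyadic_points_def dyadic_grid_def by (rule countable_UN[OF countableI_type], rule countable_image, rule countable_finite) simp

lemma dyadic_grid_Suc: "dyadic_grid m \<subseteq> dyadic_grid (Suc m)"
proof
  fix p assume "p \<in> dyadic_grid m"
  then obtain a b where "a \<le> 2 ^ m" "b \<le> 2 ^ m" "p = (real a / 2 ^ m, real b / 2 ^ m)"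
    by (auto simp: dyadic_grid_def)
  then show "p \<in> dyadic_grid (Suc m)"
    unfolding dyadic_grid_def by (intro image_eqI[of _ _ "(2 * a, 2 * b)"]) auto
qed

lemma dyadic_grid_mono: "m \<le> n \<Longrightarrow> dyadic_grid m \<subseteq> dyadic_grid n"
  by (rule lift_Suc_mono_le[of dyadic_grid]) (auto simp: dyadic_grid_Suc)

text \<open>The level may be taken at least \<open>n\<close>, since only then is the strip of width
  \<open>1 / 2 ^ n\<close> a union of cells.\<close>

lemma finite_dyadic_points_subset_grid:
  assumes "finite J" "J \<subseteq> dyadic_points"
  obtains m where "n \<le> m" "J \<subseteq> dyadic_grid m"
proof -
  have "\<exists>m. n \<le> m \<and> J \<subseteq> dyadic_grid m"
    using assms
  proof (induction J rule: finite_induct)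
    case empty
    then show ?case by auto
  next
    case (insert x J)
    then obtain m k where "n \<le> m" "J \<subseteq> dyadic_grid m" "x \<in> dyadic_grid k"
      by (auto simp: dyadic_points_def)
    then show ?case
      using dyadic_grid_mono[of m "max m k"] dyadic_grid_mono[of k "max m k"]
      by (intro exI[of _ "max m k"]) auto
  qed
  then show thesis using that by auto
qed

lemma dyadic_floor_le: "dyadic_floor n s \<le> 2 ^ n"
proof -
  have "2 ^ n * max 0 (min 1 s) \<le> 2 ^ n * (1::real)" by (intro mult_left_mono) auto
  then have "\<lfloor>2 ^ n * max 0 (min 1 s)\<rfloor> \<le> \<lfloor>2 ^ n :: real\<rfloor>" by (intro floor_mono) simp
  then show ?thesis by (simp add: dyadic_floor_def nat_le_iff)
qed

lemma dyadic_floor_point_mem: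
  "(real (dyadic_floor n s) / 2 ^ n, real (dyadic_floor n t) / 2 ^ n) \<in> dyadic_points"
  using dyadic_floor_le by (auto simp: dyadic_points_def dyadic_grid_def intro!: exI[of _ n] image_eqI[of _ _ "(dyadic_floor n s, dyadic_floor n t)"])

lemma dyadic_floor_tendsto:
  assumes "0 \<le> s" "s \<le> 1"
  shows "(\<lambda>n. real (dyadic_floor n s) / 2 ^ n) \<longlonglongrightarrow> s"
proof -
  have eq: "real (dyadic_floor n s) = real_of_int \<lfloor>2 ^ n * s\<rfloor>" for n
    using assms by (simp add: dyadic_floor_def)
  have "s - (1 / 2) ^ n \<le> real (dyadic_floor n s) / 2 ^ n" for n
  proof -
    have "2 ^ n * s - 1 \<le> real_of_int \<lfloor>2 ^ n * s\<rfloor>" by linarith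
    then have "(2 ^ n * s - 1) / 2 ^ n \<le> real (dyadic_floor n s) / 2 ^ n"
      unfolding eq by (intro divide_right_mono) auto
    then show ?thesis by (simp add: diff_divide_distrib power_one_over)
  qed
  moreover have "real (dyadic_floor n s) / 2 ^ n \<le> s" for n
    unfolding eq by (simp add: divide_le_eq mult.commute)
  moreover have "(\<lambda>n. s - (1 / 2) ^ n) \<longlonglongrightarrow> s - 0"
    by (intro tendsto_intros LIMSEQ_power_zero) auto
  ultimately show ?thesis
    by - (rule tendsto_sandwich[of "\<lambda>n. s - (1 / 2) ^ n" _ sequentially "\<lambda>_. s" s], auto)
qed

lemma dyadic_extend_eq:
  assumes f: "continuous_on unit_sq f" and z: "z \<in> unit_sq" and e: "\<And>p. p \<in> dyadic_points \<Longrightarrow> e p = f p"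
  shows "dyadic_extend e z = f z"
proof -
  have "(\<lambda>n. (real (dyadic_floor n (fst z)) / 2 ^ n, real (dyadic_floor n (snd z)) / 2 ^ n)) \<longlonglongrightarrow> (fst z, snd z)"
    using z by (intro tendsto_Pair dyadic_floor_tendsto) (auto simp: unit_sq_def)
  then have "(\<lambda>n. f (real (dyadic_floor n (fst z)) / 2 ^ n, real (dyadic_floor n (snd z)) / 2 ^ n)) \<longlonglongrightarrow> f z"
    using z subsetD[OF dyadic_points_subset dyadic_floor_point_mem]
    by (intro continuous_on_tendsto_compose[OF f] always_eventually) auto
  then show ?thesis
    unfolding dyadic_extend_def by (intro limI) (simp add: e dyadic_floor_point_mem)
qed

lemma dyadic_extend_measurable:
  "(\<lambda>x. dyadic_extend (fst x) (snd x)) \<in> borel_measurable (PiM dyadic_points (\<lambda>_. borel :: (real ^ 'd) measure) \<Otimes>\<^sub>M borel)"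
proof -
  let ?N = "PiM dyadic_points (\<lambda>_. borel :: (real ^ 'd) measure) \<Otimes>\<^sub>M (borel :: (real \<times> real) measure)"
  have [measurable]: "(\<lambda>x. dyadic_floor n (g x)) \<in> ?N \<rightarrow>\<^sub>M count_space UNIV" if [measurable]: "g \<in> borel_measurable ?N" for n g
    unfolding dyadic_floor_def by measurable
  have [measurable]: "(\<lambda>x. fst x (real (dyadic_floor n (fst (snd x))) / 2 ^ n, real (dyadic_floor n (snd (snd x))) / 2 ^ n))
     \<in> borel_measurable ?N" for n
  proof -
    \<comment> \<open>Evaluation at a random grid index is measurable because the index takes
      countably many values. Indices out of range get the default \<open>0\<close>, as they name no
      coordinate of the product.\<close>
    let ?f = "\<lambda>a b x. if a \<le> 2 ^ n \<and> b \<le> 2 ^ n then fst x (real a / 2 ^ n, real b / 2 ^ n) else (0 :: real ^ 'd)"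
    have mem: "(real a / 2 ^ n, real b / 2 ^ n) \<in> dyadic_points" if "a \<le> 2 ^ n" "b \<le> 2 ^ n" for a b
      using that by (auto simp: dyadic_points_def dyadic_grid_def)
    have f: "?f a b \<in> borel_measurable ?N" for a b
    proof (cases "a \<le> 2 ^ n \<and> b \<le> 2 ^ n")
      case True
      then have "(\<lambda>x. fst x (real a / 2 ^ n, real b / 2 ^ n)) \<in> borel_measurable ?N"
        by (intro measurable_compose[OF measurable_fst measurable_component_singleton] mem) auto
      then show ?thesis using True by simp
    next
      case False
      then have "(a \<le> 2 ^ n \<and> b \<le> 2 ^ n) = False" by simp
      then show ?thesis by (simp only: if_False) simp
    qed
    have "(\<lambda>x. ?f a (dyadic_floor n (snd (snd x))) x) \<in> borel_measurable ?N" for a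
      by (rule measurable_compose_countable[of "\<lambda>b. ?f a b"]) (rule f, measurable)
    then have "(\<lambda>x. ?f (dyadic_floor n (fst (snd x))) (dyadic_floor n (snd (snd x))) x) \<in> borel_measurable ?N"
      by (rule measurable_compose_countable[of "\<lambda>a x. ?f a (dyadic_floor n (snd (snd x))) x"]) measurable
    then show ?thesis by (simp add: dyadic_floor_le)
  qed
  show ?thesis unfolding dyadic_extend_def by measurable
qed

text \<open>The one-dimensional Cameron-Martin formula, by completing the square in the normal
  density.\<close>

lemma gaussian_shift:
  assumes X: "distributed M lborel X (normal_density 0 \<sigma>)" and \<sigma>: "0 < \<sigma>"
    and [measurable]: "\<phi> \<in> borel_measurable borel"
  shows "(\<integral>\<^sup>+\<omega>. \<phi> (X \<omega> + a * \<sigma>\<^sup>2) \<partial>M) = (\<integral>\<^sup>+\<omega>. \<phi> (X \<omega>) * ennreal (exp (a * X \<omega> - a\<^sup>2 * \<sigma>\<^sup>2 / 2)) \<partial>M)"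
proof -
  have density: "normal_density 0 \<sigma> (x - a * \<sigma>\<^sup>2) = normal_density 0 \<sigma> x * exp (a * x - a\<^sup>2 * \<sigma>\<^sup>2 / 2)" for x
  proof -
    have "- (x - a * \<sigma>\<^sup>2)\<^sup>2 / (2 * \<sigma>\<^sup>2) = - x\<^sup>2 / (2 * \<sigma>\<^sup>2) + (a * x - a\<^sup>2 * \<sigma>\<^sup>2 / 2)"
      using \<sigma> by (simp add: field_simps power2_eq_square)
    then show ?thesis by (simp only: normal_density_def diff_zero exp_add mult.assoc)
  qed
  have "(\<integral>\<^sup>+\<omega>. \<phi> (X \<omega> + a * \<sigma>\<^sup>2) \<partial>M) = (\<integral>\<^sup>+x. ennreal (normal_density 0 \<sigma> x) * \<phi> (x + a * \<sigma>\<^sup>2) \<partial>lborel)"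
    by (subst distributed_nn_integral[OF X, of "\<lambda>x. \<phi> (x + a * \<sigma>\<^sup>2)"]) simp_all
  also have "\<dots> = (\<integral>\<^sup>+x. ennreal (normal_density 0 \<sigma> (x - a * \<sigma>\<^sup>2)) * \<phi> x \<partial>lborel)"
    by (subst nn_integral_real_affine[of "\<lambda>x. ennreal (normal_density 0 \<sigma> (x - a * \<sigma>\<^sup>2)) * \<phi> x" 1 "a * \<sigma>\<^sup>2"])
       (simp_all add: add.commute)
  also have "\<dots> = (\<integral>\<^sup>+x. ennreal (normal_density 0 \<sigma> x) * (\<phi> x * ennreal (exp (a * x - a\<^sup>2 * \<sigma>\<^sup>2 / 2))) \<partial>lborel)"
    by (simp add: density ennreal_mult mult_ac)
  also have "\<dots> = (\<integral>\<^sup>+\<omega>. \<phi> (X \<omega>) * ennreal (exp (a * X \<omega> - a\<^sup>2 * \<sigma>\<^sup>2 / 2)) \<partial>M)"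
    by (rule distributed_nn_integral[OF X]) simp
  finally show ?thesis .
qed

text \<open>The square of the weight with parameter \<open>a\<close> is a constant times the weight
  with parameter \<open>2 * a\<close>, and the latter has mean one by \<open>gaussian_shift\<close>
  with the constant function \<open>1\<close>.\<close>

lemma (in prob_space) gaussian_tilt_second_moment:
  assumes X: "distributed M lborel X (normal_density 0 \<sigma>)" and \<sigma>: "0 < \<sigma>"
  shows "(\<integral>\<^sup>+\<omega>. ennreal (exp (a * X \<omega> - a\<^sup>2 * \<sigma>\<^sup>2 / 2)) ^ 2 \<partial>M) = ennreal (exp (a\<^sup>2 * \<sigma>\<^sup>2))"
proof -
  have [measurable]: "X \<in> borel_measurable M"
    using distributed_measurable[OF X] by simp
  have "ennreal (exp (a * x - a\<^sup>2 * \<sigma>\<^sup>2 / 2)) ^ 2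
      = ennreal (exp (a\<^sup>2 * \<sigma>\<^sup>2)) * (1 * ennreal (exp ((2 * a) * x - (2 * a)\<^sup>2 * \<sigma>\<^sup>2 / 2)))" for x
    by (simp add: power2_eq_square ennreal_mult[symmetric] exp_add[symmetric])
  then have "(\<integral>\<^sup>+\<omega>. ennreal (exp (a * X \<omega> - a\<^sup>2 * \<sigma>\<^sup>2 / 2)) ^ 2 \<partial>M)
     = ennreal (exp (a\<^sup>2 * \<sigma>\<^sup>2)) * (\<integral>\<^sup>+\<omega>. 1 * ennreal (exp ((2 * a) * X \<omega> - (2 * a)\<^sup>2 * \<sigma>\<^sup>2 / 2)) \<partial>M)"
    by (simp add: nn_integral_cmult)
  also have "(\<integral>\<^sup>+\<omega>. 1 * ennreal (exp ((2 * a) * X \<omega> - (2 * a)\<^sup>2 * \<sigma>\<^sup>2 / 2)) \<partial>M) = 1"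
    using gaussian_shift[OF X \<sigma>, of "\<lambda>_. 1" "2 * a"] by (simp add: emeasure_space_1)
  finally show ?thesis by simp
qed

text \<open>Peel off the index of largest \<open>key\<close>: the intersection of the remaining
  events lies in its past \<open>G i\<close>, hence factors off. Independence from the past, one
  variable at a time, thus yields joint independence.\<close>

lemma (in prob_space) indep_vars_sequentialI:
  fixes key :: "'i \<Rightarrow> nat" and X :: "'i \<Rightarrow> 'a \<Rightarrow> real"
  assumes "finite I" and key: "inj_on key I"
    and rv: "\<And>i. i \<in> I \<Longrightarrow> X i \<in> borel_measurable M"
    and indep: "\<And>i. i \<in> I \<Longrightarrow> indep_set {X i -` A \<inter> space M | A. A \<in> sets borel} (G i)"
    and G: "\<And>i. i \<in> I \<Longrightarrow> sigma_algebra (space M) (G i)"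
    and past: "\<And>i j A. i \<in> I \<Longrightarrow> j \<in> I \<Longrightarrow> key j < key i \<Longrightarrow> A \<in> sets borel \<Longrightarrow> X j -` A \<inter> space M \<in> G i"
  shows "indep_vars (\<lambda>_. borel) X I"
  unfolding indep_vars_def2
proof (intro conjI ballI)
  let ?F = "\<lambda>i. {X i -` A \<inter> space M | A. A \<in> sets borel}"
  show "indep_sets ?F I"
    unfolding indep_sets_def
  proof (intro conjI ballI allI impI)
    show "?F i \<subseteq> events" if "i \<in> I" for i
      using rv[OF that] by (auto intro: measurable_sets)
    fix J A assume J: "J \<subseteq> I" "J \<noteq> {}" "finite J" and A: "A \<in> Pi J ?F"
    have "J \<noteq> {} \<longrightarrow> prob (\<Inter>j\<in>J. A j) = (\<Prod>j\<in>J. prob (A j))"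
      using J(3,1) A
    proof (induction J rule: finite_psubset_induct)
      case (psubset J)
      show ?case
      proof
        assume "J \<noteq> {}"
        then have "Max (key ` J) \<in> key ` J" using psubset.hyps by (intro Max_in) auto
        then obtain i where i: "i \<in> J" "key i = Max (key ` J)" by (metis imageE)
        let ?J = "J - {i}"
        show "prob (\<Inter>j\<in>J. A j) = (\<Prod>j\<in>J. prob (A j))"
        proof (cases "?J = {}")
          case True
          then have "J = {i}" using i by auto
          then show ?thesis by simp
        next
          case False
          have IH: "prob (\<Inter>j\<in>?J. A j) = (\<Prod>j\<in>?J. prob (A j))"
            using psubset.IH[of ?J] psubset.prems i(1) False by auto
          interpret G: sigma_algebra "space M" "G i"
            using G psubset.prems i by auto
          have "A j \<in> G i" if j: "j \<in> ?J" for j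
          proof -
            have "key j \<noteq> key i"
              using inj_onD[OF key, of j i] j i psubset.prems by auto
            moreover have "key j \<le> key i"
              using j i psubset.hyps by auto
            ultimately have lt: "key j < key i" by simp
            have "A j \<in> ?F j" using psubset.prems(2) j by (intro Pi_mem[of A J]) auto
            then obtain B where "B \<in> sets borel" "A j = X j -` B \<inter> space M"
              by auto
            then show ?thesis using past[of i j B] lt i j psubset.prems by auto
          qed
          then have "(\<Inter>j\<in>?J. A j) \<in> G i"
            using False psubset.hyps by (intro G.finite_INT) auto
          moreover have "A i \<in> ?F i" using psubset.prems(2) i(1) by (rule Pi_mem)
          ultimately have "prob (A i \<inter> (\<Inter>j\<in>?J. A j)) = prob (A i) * prob (\<Inter>j\<in>?J. A j)"
            using psubset.prems(1) i by (intro indep_setD[OF indep[of i]]) auto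
          moreover have "(\<Inter>j\<in>J. A j) = A i \<inter> (\<Inter>j\<in>?J. A j)" using i by auto
          moreover have "(\<Prod>j\<in>J. prob (A j)) = prob (A i) * (\<Prod>j\<in>?J. prob (A j))"
            using i psubset.hyps by (simp add: prod.remove)
          ultimately show ?thesis using IH by simp
        qed
      qed
    qed
    then show "prob (\<Inter>j\<in>J. A j) = (\<Prod>j\<in>J. prob (A j))" using J by simp
  qed
qed (use rv in auto)

section \<open>Increments of the sheet over dyadic cells\<close>

definition cell_incr :: "(real \<times> real \<Rightarrow> real) \<Rightarrow> nat \<Rightarrow> nat \<times> nat \<Rightarrow> real" where
  "cell_incr f m c =
     f (real (Suc (fst c)) / 2 ^ m, real (Suc (snd c)) / 2 ^ m) - f (real (fst c) / 2 ^ m, real (Suc (snd c)) / 2 ^ m)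
     - f (real (Suc (fst c)) / 2 ^ m, real (snd c) / 2 ^ m) + f (real (fst c) / 2 ^ m, real (snd c) / 2 ^ m)"

text \<open>The mixed second differences telescope in each coordinate in turn.\<close>

lemma sum_cell_incr:
  assumes "p \<le> p'" "q \<le> q'"
  shows "(\<Sum>c\<in>{p..<p'} \<times> {q..<q'}. cell_incr f m c) =
    f (real p' / 2 ^ m, real q' / 2 ^ m) - f (real p / 2 ^ m, real q' / 2 ^ m)
    - f (real p' / 2 ^ m, real q / 2 ^ m) + f (real p / 2 ^ m, real q / 2 ^ m)"
proof -
  define g where "g a b = f (real a / 2 ^ m, real b / 2 ^ m)" for a b :: nat
  have "(\<Sum>c\<in>{p..<p'} \<times> {q..<q'}. cell_incr f m c) = (\<Sum>a=p..<p'. \<Sum>b=q..<q'. cell_incr f m (a, b))"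
    by (simp add: sum.cartesian_product split_beta')
  also have "\<dots> = (\<Sum>a=p..<p'. \<Sum>b=q..<q'. (g (Suc a) (Suc b) - g a (Suc b)) - (g (Suc a) b - g a b))"
    by (simp add: cell_incr_def g_def algebra_simps)
  also have "\<dots> = (\<Sum>a=p..<p'. (g (Suc a) q' - g a q') - (g (Suc a) q - g a q))"
    using sum_Suc_diff'[OF assms(2), of "\<lambda>b. g (Suc a) b - g a b" for a] by simp
  also have "\<dots> = (\<Sum>a=p..<p'. (g (Suc a) q' - g (Suc a) q) - (g a q' - g a q))"
    by (rule sum.cong) auto
  also have "\<dots> = (g p' q' - g p' q) - (g p q' - g p q)"
    by (rule sum_Suc_diff'[OF assms(1), of "\<lambda>a. g a q' - g a q"])
  finally show ?thesis by (simp add: g_def)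
qed

definition cells :: "nat \<Rightarrow> (nat \<times> nat) set" where
  "cells m = {0..<2 ^ m} \<times> {0..<2 ^ m}"

lemma finite_cells [simp]: "finite (cells m)"
  by (simp add: cells_def)

text \<open>At levels \<open>m \<ge> n\<close> the strip of width \<open>1 / 2 ^ n\<close> is a union of cells.\<close>

definition in_strip :: "nat \<Rightarrow> nat \<Rightarrow> nat \<times> nat \<Rightarrow> bool" where
  "in_strip n m c \<longleftrightarrow> fst c < 2 ^ (m - n) \<or> snd c < 2 ^ (m - n)"

text \<open>The mixed difference of a product of one-variable functions is the product of their
  differences. Those of \<open>\<phi>\<close> vanish before the strip's edge and are a full cell
  width after it, because the edge \<open>1 / 2 ^ n\<close> is a grid coordinate at level
  \<open>m\<close>.\<close>

lemma cell_incr_strip_area: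
  assumes "n \<le> m"
  shows "cell_incr (strip_area (1 / 2 ^ n)) m c = (if in_strip n m c then (1 / 2 ^ m)\<^sup>2 else 0)"
proof -
  define N :: nat where "N = 2 ^ (m - n)"
  have pow: "(2::real) ^ m = 2 ^ n * 2 ^ (m - n)"
    using assms by (simp add: power_add[symmetric])
  have r: "(1::real) / 2 ^ n = real N / 2 ^ m"
    by (simp add: N_def pow)
  define \<phi> where "\<phi> a = max (real a / 2 ^ m - 1 / 2 ^ n) 0" for a :: nat
  have \<phi>: "\<phi> (Suc a) - \<phi> a = (if a < N then 0 else 1 / 2 ^ m)" for a
  proof (cases "a < N")
    case True
    then have "real (Suc a) \<le> real N" by linarith
    then have "real (Suc a) / 2 ^ m \<le> real N / 2 ^ m" "real a / 2 ^ m \<le> real N / 2 ^ m"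
      by (intro divide_right_mono; simp)+
    then show ?thesis using True unfolding \<phi>_def r by simp
  next
    case False
    then have "real N \<le> real a" by simp
    then have "real N / 2 ^ m \<le> real a / 2 ^ m" "real N / 2 ^ m \<le> real (Suc a) / 2 ^ m"
      by (intro divide_right_mono; simp)+
    then show ?thesis using False unfolding \<phi>_def r by (simp add: diff_divide_distrib[symmetric])
  qed
  obtain a b where c: "c = (a, b)" by (cases c)
  have "cell_incr (strip_area (1 / 2 ^ n)) m c
      = (real (Suc a) / 2 ^ m - real a / 2 ^ m) * (real (Suc b) / 2 ^ m - real b / 2 ^ m)
        - (\<phi> (Suc a) - \<phi> a) * (\<phi> (Suc b) - \<phi> b)"
    unfolding c cell_incr_def strip_area_def \<phi>_def fst_conv snd_conv by (simp only: algebra_simps)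
  also have "\<dots> = (1 / 2 ^ m)\<^sup>2 - (\<phi> (Suc a) - \<phi> a) * (\<phi> (Suc b) - \<phi> b)"
    by (simp add: diff_divide_distrib[symmetric] power2_eq_square)
  also have "\<dots> = (if in_strip n m c then (1 / 2 ^ m)\<^sup>2 else 0)"
    unfolding \<phi> c in_strip_def N_def[symmetric] by (auto simp: power2_eq_square)
  finally show ?thesis .
qed

lemma sum_in_strip:
  fixes g :: "nat \<times> nat \<Rightarrow> real"
  assumes "n \<le> m"
  shows "(\<Sum>c\<in>cells m. if in_strip n m c then g c else 0) =
    sum g (cells m) - sum g ({2 ^ (m - n)..<2 ^ m} \<times> {2 ^ (m - n)..<2 ^ m})"
proof -
  let ?I = "{2 ^ (m - n)..<2 ^ m} \<times> {2 ^ (m - n)..<2 ^ m}"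
  have "(\<Sum>c\<in>cells m. if in_strip n m c then g c else 0) = (\<Sum>c\<in>cells m. g c - (if c \<in> ?I then g c else 0))"
    by (rule sum.cong) (auto simp: in_strip_def cells_def)
  also have "\<dots> = sum g (cells m) - (\<Sum>c\<in>cells m. if c \<in> ?I then g c else 0)"
    by (rule sum_subtractf)
  also have "(\<Sum>c\<in>cells m. if c \<in> ?I then g c else 0) = sum g (cells m \<inter> ?I)"
    by (rule sum.inter_restrict[symmetric]) simp
  also have "cells m \<inter> ?I = ?I" by (auto simp: cells_def)
  finally show ?thesis .
qed

locale brownian_sheet_space = prob_space M
  for M :: "'w measure" and F :: "real \<times> real \<Rightarrow> 'w measure" and W :: "real \<times> real \<Rightarrow> 'w \<Rightarrow> real ^ 'd" +
  assumes filt: "filtration2 M F" and sheet: "brownian_sheet M F W"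
begin

lemmas F_sub = filt[unfolded filtration2_def, THEN conjunct1, rule_format]
lemmas F_sets_mono = filt[unfolded filtration2_def, THEN conjunct2, THEN conjunct1, rule_format]
lemmas W_F_measurable = sheet[unfolded brownian_sheet_def, THEN conjunct1, rule_format]
lemmas W_continuous = sheet[unfolded brownian_sheet_def, THEN conjunct2, THEN conjunct1, rule_format]
lemmas W_axes = sheet[unfolded brownian_sheet_def, THEN conjunct2, THEN conjunct2, THEN conjunct1, rule_format]
lemmas W_incr = sheet[unfolded brownian_sheet_def, THEN conjunct2, THEN conjunct2, THEN conjunct2, THEN conjunct1, rule_format]
lemmas W_components_indep = sheet[unfolded brownian_sheet_def, THEN conjunct2, THEN conjunct2, THEN conjunct2, THEN conjunct2]

lemma F_mono:
  assumes "(s, t) \<in> unit_sq" "(s', t') \<in> unit_sq" "s \<le> s'" "t \<le> t'"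
  shows "subalgebra (F (s', t')) (F (s, t))"
  using F_sub[OF assms(1)] F_sub[OF assms(2)] F_sets_mono[OF assms] by (simp add: subalgebra_def)

lemma W_adapted:
  assumes "(s, t) \<in> unit_sq" "(s', t') \<in> unit_sq" "s \<le> s'" "t \<le> t'"
  shows "W (s, t) \<in> borel_measurable (F (s', t'))"
  by (rule measurable_from_subalg[OF F_mono[OF assms] W_F_measurable[OF assms(1)]])

lemma W_measurable: "z \<in> unit_sq \<Longrightarrow> W z \<in> borel_measurable M"
  by (rule measurable_from_subalg[OF F_sub W_F_measurable])

definition sheet_incr :: "nat \<Rightarrow> 'd \<Rightarrow> nat \<times> nat \<Rightarrow> 'w \<Rightarrow> real" where
  "sheet_incr m i c \<omega> = cell_incr (\<lambda>z. W z \<omega> $ i) m c"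

lemma sheet_incr_eq:
  "sheet_incr m i (a, b) = rect_incr W i (real a / 2 ^ m) (real b / 2 ^ m) (real (Suc a) / 2 ^ m) (real (Suc b) / 2 ^ m)"
  by (simp add: fun_eq_iff sheet_incr_def cell_incr_def rect_incr_def)

lemma cell_coordinates:
  assumes "a < 2 ^ m"
  shows "0 \<le> real a / 2 ^ m" "real a / 2 ^ m < real (Suc a) / 2 ^ m" "real (Suc a) / 2 ^ m \<le> 1"
proof -
  have "Suc a \<le> 2 ^ m" using assms by simp
  then have "real (Suc a) \<le> 2 ^ m" by (metis of_nat_le_iff of_nat_numeral of_nat_power)
  then show "0 \<le> real a / 2 ^ m" "real a / 2 ^ m < real (Suc a) / 2 ^ m" "real (Suc a) / 2 ^ m \<le> 1"
    by (auto intro!: divide_strict_right_mono)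
qed

lemma sheet_incr_distributed:
  assumes "c \<in> cells m"
  shows "distributed M lborel (sheet_incr m i c) (normal_density 0 (1 / 2 ^ m))"
proof -
  obtain a b where c: "c = (a, b)" "a < 2 ^ m" "b < 2 ^ m"
    using assms by (auto simp: cells_def)
  note ca = cell_coordinates[OF c(2)] and cb = cell_coordinates[OF c(3)]
  have "distributed M lborel (sheet_incr m i c)
    (normal_density 0 (sqrt ((real (Suc a) / 2 ^ m - real a / 2 ^ m) * (real (Suc b) / 2 ^ m - real b / 2 ^ m))))"
    unfolding c sheet_incr_eq by (rule W_incr[THEN conjunct1]) (use ca cb in auto)
  also have "(real (Suc a) / 2 ^ m - real a / 2 ^ m) * (real (Suc b) / 2 ^ m - real b / 2 ^ m) = (1 / 2 ^ m)\<^sup>2"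
    by (simp add: diff_divide_distrib[symmetric] power2_eq_square)
  finally show ?thesis by simp
qed

lemma sheet_incr_measurable: "c \<in> cells m \<Longrightarrow> sheet_incr m i c \<in> borel_measurable M"
  using distributed_measurable[OF sheet_incr_distributed] by simp

lemma rect_incr_adapted:
  assumes "0 \<le> s" "s \<le> s'" "s' \<le> u" "u \<le> 1" "0 \<le> t" "t \<le> t'" "t' \<le> v" "v \<le> 1"
  shows "rect_incr W i s t s' t' \<in> borel_measurable (F (u, v))"
proof -
  have [measurable]: "W (s', t') \<in> borel_measurable (F (u, v))" "W (s, t') \<in> borel_measurable (F (u, v))"
    "W (s', t) \<in> borel_measurable (F (u, v))" "W (s, t) \<in> borel_measurable (F (u, v))"
    using assms by (auto intro!: W_adapted simp: unit_sq_def)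
  show ?thesis unfolding rect_incr_def[abs_def] by measurable
qed

text \<open>In lexicographic order, each cell increment is independent of the \<open>\<sigma>\<close>-algebra
  \<open>F (s, 1) \<or> F (1, t)\<close> at its lower left corner, which contains all preceding increments.\<close>

lemma sheet_incr_indep: "indep_vars (\<lambda>_. borel) (\<lambda>c. sheet_incr m i c) (cells m)"
\<comment> \<open>The key is a two-digit number in base \<open>2 ^ m\<close>, so its numerical order
  is the lexicographic one.\<close>
proof (rule indep_vars_sequentialI[where key="\<lambda>(a, b). a * 2 ^ m + b" and
      G="\<lambda>(a, b). sigma_sets (space M) (sets (F (real a / 2 ^ m, 1)) \<union> sets (F (1, real b / 2 ^ m)))"])
  have key: "a * 2 ^ m + b < a' * 2 ^ m + b' \<Longrightarrow> b < 2 ^ m \<Longrightarrow> b' < 2 ^ m \<Longrightarrow> a < a' \<or> a = a' \<and> b < b'"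
    for a b a' b' :: nat
  proof (rule ccontr)
    assume *: "a * 2 ^ m + b < a' * 2 ^ m + b'" "b < 2 ^ m" "b' < 2 ^ m" "\<not> (a < a' \<or> a = a' \<and> b < b')"
    then have "a' < a" by (cases "a = a'") auto
    then have "Suc a' * 2 ^ m \<le> a * 2 ^ m" by (intro mult_le_mono1) simp
    then show False using * by simp
  qed
  show "inj_on (\<lambda>(a, b). a * 2 ^ m + b) (cells m)"
  proof (rule inj_onI)
    fix x y assume "x \<in> cells m" "y \<in> cells m" and
      eq: "(case x of (a, b) \<Rightarrow> a * 2 ^ m + b) = (case y of (a, b) \<Rightarrow> a * 2 ^ m + b)"
    then obtain a b a' b' where xy: "x = (a, b)" "y = (a', b')" "b < 2 ^ m" "b' < 2 ^ m"
      by (auto simp: cells_def)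
    then have "(a * 2 ^ m + b) div 2 ^ m = (a' * 2 ^ m + b') div 2 ^ m"
      "(a * 2 ^ m + b) mod 2 ^ m = (a' * 2 ^ m + b') mod 2 ^ m" using eq by auto
    then show "x = y" using xy by simp
  qed
  show "indep_set {sheet_incr m i c -` A \<inter> space M |A. A \<in> sets borel}
      (case c of (a, b) \<Rightarrow> sigma_sets (space M) (sets (F (real a / 2 ^ m, 1)) \<union> sets (F (1, real b / 2 ^ m))))"
    if "c \<in> cells m" for c
  proof -
    obtain a b where c: "c = (a, b)" "a < 2 ^ m" "b < 2 ^ m"
      using \<open>c \<in> cells m\<close> by (auto simp: cells_def)
    note ca = cell_coordinates[OF c(2)] and cb = cell_coordinates[OF c(3)]
    show ?thesis
      unfolding c(1) prod.case sheet_incr_eq by (rule W_incr[THEN conjunct2]) (use ca cb in auto)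
  qed
  have sq: "(real a / 2 ^ m, 1) \<in> unit_sq" "(1, real a / 2 ^ m) \<in> unit_sq" if "a < 2 ^ m" for a
  proof -
    have "0 \<le> real a / 2 ^ m" "real a / 2 ^ m \<le> 1" using cell_coordinates[OF that] by linarith+
    then show "(real a / 2 ^ m, 1) \<in> unit_sq" "(1, real a / 2 ^ m) \<in> unit_sq"
      unfolding unit_sq_def mem_Times_iff fst_conv snd_conv atLeastAtMost_iff by simp_all
  qed
  show "sigma_algebra (space M)
      (case c of (a, b) \<Rightarrow> sigma_sets (space M) (sets (F (real a / 2 ^ m, 1)) \<union> sets (F (1, real b / 2 ^ m))))"
    if c: "c \<in> cells m" for c
  proof -
    obtain a b where ab: "c = (a, b)" "a < 2 ^ m" "b < 2 ^ m"
      using c by (auto simp: cells_def)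
    have "sets (F (real a / 2 ^ m, 1)) \<union> sets (F (1, real b / 2 ^ m)) \<subseteq> Pow (space M)"
      using F_sub[OF sq(1)[OF ab(2)]] F_sub[OF sq(2)[OF ab(3)]]
        sets.space_closed[of "F (real a / 2 ^ m, 1)"] sets.space_closed[of "F (1, real b / 2 ^ m)"]
      by (simp add: subalgebra_def)
    then show ?thesis unfolding ab(1) prod.case by (rule sigma_algebra_sigma_sets)
  qed
  show "sheet_incr m i d -` A \<inter> space M \<in>
      (case c of (a, b) \<Rightarrow> sigma_sets (space M) (sets (F (real a / 2 ^ m, 1)) \<union> sets (F (1, real b / 2 ^ m))))"
    if cd: "c \<in> cells m" "d \<in> cells m"
      and lt: "(case d of (a, b) \<Rightarrow> a * 2 ^ m + b) < (case c of (a, b) \<Rightarrow> a * 2 ^ m + b)"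
      and A: "A \<in> sets borel" for c d A
  proof -
    obtain a b where c: "c = (a, b)" "a < 2 ^ m" "b < 2 ^ m"
      using cd by (auto simp: cells_def)
    obtain a' b' where d: "d = (a', b')" "a' < 2 ^ m" "b' < 2 ^ m"
      using cd by (auto simp: cells_def)
    note da = cell_coordinates[OF d(2)] and db = cell_coordinates[OF d(3)]
    note ca = cell_coordinates[OF c(2)] and cb = cell_coordinates[OF c(3)]
    have sp: "space (F (real a / 2 ^ m, 1)) = space M" "space (F (1, real b / 2 ^ m)) = space M"
      using F_sub[OF sq(1)[OF c(2)]] F_sub[OF sq(2)[OF c(3)]] by (auto simp: subalgebra_def)
    have "a' < a \<or> a' = a \<and> b' < b"
      using lt c d by (intro key) auto
    \<comment> \<open>An earlier cell lies either entirely left of the vertical line or entirely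
      below the horizontal line through the lower left corner of \<open>c\<close>, hence is known to
      one of the two filtrations.\<close>
    then consider "Suc a' \<le> a" | "Suc b' \<le> b" by linarith
    then have "sheet_incr m i d -` A \<inter> space M \<in> sets (F (real a / 2 ^ m, 1)) \<union> sets (F (1, real b / 2 ^ m))"
    proof cases
      case 1
      then have "real (Suc a') / 2 ^ m \<le> real a / 2 ^ m" by (intro divide_right_mono) auto
      then have "sheet_incr m i d \<in> borel_measurable (F (real a / 2 ^ m, 1))"
        unfolding d(1) sheet_incr_eq using da db ca by (intro rect_incr_adapted) linarith+
      from measurable_sets[OF this A] show ?thesis by (simp add: sp)
    next
      case 2
      then have "real (Suc b') / 2 ^ m \<le> real b / 2 ^ m" by (intro divide_right_mono) auto
      then have "sheet_incr m i d \<in> borel_measurable (F (1, real b / 2 ^ m))"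
        unfolding d(1) sheet_incr_eq using da db cb by (intro rect_incr_adapted) linarith+
      from measurable_sets[OF this A] show ?thesis by (simp add: sp)
    qed
    then show ?thesis unfolding c(1) prod.case by (rule sigma_sets.Basic)
  qed
qed (simp_all add: sheet_incr_measurable)

text \<open>Independence enters twice: across components it is a hypothesis about whole paths,
  applied to the path functionals \<open>Y i\<close>; within a component it is
  \<open>sheet_incr_indep\<close>.\<close>

lemma nn_integral_prod_sheet_incr:
  fixes \<phi> :: "'d \<Rightarrow> nat \<times> nat \<Rightarrow> real \<Rightarrow> ennreal"
  assumes \<phi> [measurable]: "\<And>i c. \<phi> i c \<in> borel_measurable borel"
  shows "(\<integral>\<^sup>+\<omega>. (\<Prod>i\<in>UNIV. \<Prod>c\<in>cells m. \<phi> i c (sheet_incr m i c \<omega>)) \<partial>M)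
    = (\<Prod>i\<in>UNIV. \<Prod>c\<in>cells m. \<integral>\<^sup>+\<omega>. \<phi> i c (sheet_incr m i c \<omega>) \<partial>M)"
proof -
  define Y where "Y i p = (\<Prod>c\<in>cells m. \<phi> i c (cell_incr p m c))" for i and p :: "real \<times> real \<Rightarrow> real"
  have corners: "(real (Suc (fst c)) / 2 ^ m, real (Suc (snd c)) / 2 ^ m) \<in> unit_sq"
    "(real (fst c) / 2 ^ m, real (Suc (snd c)) / 2 ^ m) \<in> unit_sq"
    "(real (Suc (fst c)) / 2 ^ m, real (snd c) / 2 ^ m) \<in> unit_sq"
    "(real (fst c) / 2 ^ m, real (snd c) / 2 ^ m) \<in> unit_sq" if "c \<in> cells m" for c
  proof -
    have "fst c < 2 ^ m" "snd c < 2 ^ m" using that by (auto simp: cells_def)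
    note ca = cell_coordinates[OF this(1)] and cb = cell_coordinates[OF this(2)]
    have "0 \<le> real (Suc (fst c)) / 2 ^ m" "0 \<le> real (Suc (snd c)) / 2 ^ m"
      "real (fst c) / 2 ^ m \<le> 1" "real (snd c) / 2 ^ m \<le> 1"
      using ca cb by linarith+
    then show "(real (Suc (fst c)) / 2 ^ m, real (Suc (snd c)) / 2 ^ m) \<in> unit_sq"
      "(real (fst c) / 2 ^ m, real (Suc (snd c)) / 2 ^ m) \<in> unit_sq"
      "(real (Suc (fst c)) / 2 ^ m, real (snd c) / 2 ^ m) \<in> unit_sq"
      "(real (fst c) / 2 ^ m, real (snd c) / 2 ^ m) \<in> unit_sq"
      unfolding unit_sq_def mem_Times_iff fst_conv snd_conv atLeastAtMost_iff using ca cb by blast+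
  qed
  have Y: "Y i \<in> borel_measurable (PiM unit_sq (\<lambda>_. borel))" for i
    unfolding Y_def
  proof (rule borel_measurable_prod_ennreal)
    fix c assume "c \<in> cells m"
    note [measurable] = measurable_component_singleton[OF corners(1)[OF this], of "\<lambda>_. borel"]
      measurable_component_singleton[OF corners(2)[OF this], of "\<lambda>_. borel"]
      measurable_component_singleton[OF corners(3)[OF this], of "\<lambda>_. borel"]
      measurable_component_singleton[OF corners(4)[OF this], of "\<lambda>_. borel"]
    show "(\<lambda>p. \<phi> i c (cell_incr p m c)) \<in> borel_measurable (PiM unit_sq (\<lambda>_. borel))"
      unfolding cell_incr_def by measurable
  qed
  from indep_vars_compose2[OF W_components_indep Y]
  have "indep_vars (\<lambda>_. borel) (\<lambda>i \<omega>. Y i (\<lambda>z\<in>unit_sq. W z \<omega> $ i)) UNIV" .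
  also have "(\<lambda>i \<omega>. Y i (\<lambda>z\<in>unit_sq. W z \<omega> $ i)) = (\<lambda>i \<omega>. \<Prod>c\<in>cells m. \<phi> i c (sheet_incr m i c \<omega>))"
    using corners by (auto simp: fun_eq_iff Y_def sheet_incr_def cell_incr_def intro!: prod.cong)
  finally have "(\<integral>\<^sup>+\<omega>. (\<Prod>i\<in>UNIV. \<Prod>c\<in>cells m. \<phi> i c (sheet_incr m i c \<omega>)) \<partial>M)
    = (\<Prod>i\<in>UNIV. \<integral>\<^sup>+\<omega>. (\<Prod>c\<in>cells m. \<phi> i c (sheet_incr m i c \<omega>)) \<partial>M)"
    by (intro indep_vars_nn_integral) auto
  moreover have "(\<integral>\<^sup>+\<omega>. (\<Prod>c\<in>cells m. \<phi> i c (sheet_incr m i c \<omega>)) \<partial>M)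
      = (\<Prod>c\<in>cells m. \<integral>\<^sup>+\<omega>. \<phi> i c (sheet_incr m i c \<omega>) \<partial>M)" for i
    using indep_vars_compose2[OF sheet_incr_indep \<phi>] by (intro indep_vars_nn_integral) auto
  ultimately show ?thesis by simp
qed

end

section \<open>Translations of the sheet\<close>

text \<open>This inverts the passage to increments: at a grid point it adds up the increments of all
  cells to the lower left, which recovers any function vanishing on the axes.\<close>

definition cell_sum :: "nat \<Rightarrow> ('d \<times> nat \<times> nat \<Rightarrow> real) \<Rightarrow> real \<times> real \<Rightarrow> real ^ 'd" where
  "cell_sum m x z = (\<chi> i. \<Sum>c\<in>{c \<in> cells m. real (Suc (fst c)) / 2 ^ m \<le> fst z \<and> real (Suc (snd c)) / 2 ^ m \<le> snd z}. x (i, c))"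

lemma cells_below:
  assumes "p \<le> 2 ^ m" "q \<le> 2 ^ m"
  shows "{c \<in> cells m. real (Suc (fst c)) / 2 ^ m \<le> real p / 2 ^ m \<and> real (Suc (snd c)) / 2 ^ m \<le> real q / 2 ^ m}
    = {0..<p} \<times> {0..<q}"
proof -
  have "real (Suc a) / 2 ^ m \<le> real k / 2 ^ m \<longleftrightarrow> a < k" for a k
    by (simp add: divide_le_cancel Suc_le_eq[symmetric] del: of_nat_Suc)
  then show ?thesis using assms by (auto simp: cells_def simp del: of_nat_Suc)
qed

lemma cell_sum_cell_incr:
  fixes f :: "real \<times> real \<Rightarrow> real ^ 'd"
  assumes z: "z \<in> dyadic_grid m"
    and axes: "\<And>u. u \<in> {0..1} \<Longrightarrow> f (0, u) = 0" "\<And>u. u \<in> {0..1} \<Longrightarrow> f (u, 0) = 0"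
    and x: "\<And>i c. c \<in> cells m \<Longrightarrow> x (i, c) = cell_incr (\<lambda>z. f z $ i) m c"
  shows "cell_sum m x z = f z"
proof (rule vec_eq_iff[THEN iffD2], rule allI)
  fix i
  obtain p q where pq: "p \<le> 2 ^ m" "q \<le> 2 ^ m" and z_eq: "z = (real p / 2 ^ m, real q / 2 ^ m)"
    using z by (auto simp: dyadic_grid_def)
  have "z \<in> unit_sq" using z dyadic_grid_subset by auto
  then have u: "real p / 2 ^ m \<in> {0..1}" "real q / 2 ^ m \<in> {0..1}"
    unfolding z_eq unit_sq_def by auto
  have sub: "{0..<p} \<times> {0..<q} \<subseteq> cells m" using pq by (auto simp: cells_def)
  have "cell_sum m x z $ i = (\<Sum>c\<in>{0..<p} \<times> {0..<q}. x (i, c))"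
    unfolding cell_sum_def vec_lambda_beta z_eq fst_conv snd_conv cells_below[OF pq] ..
  also have "\<dots> = (\<Sum>c\<in>{0..<p} \<times> {0..<q}. cell_incr (\<lambda>z. f z $ i) m c)"
    by (rule sum.cong) (use x sub in auto)
  also have "\<dots> = f z $ i"
    using axes u axes(1)[of 0] unfolding z_eq by (subst sum_cell_incr) auto
  finally show "cell_sum m x z $ i = f z $ i" .
qed

lemma cell_incr_add: "cell_incr (\<lambda>z. f z + g z) m c = cell_incr f m c + cell_incr g m c"
  by (simp add: cell_incr_def)

lemma cell_incr_cmult: "cell_incr (\<lambda>z. a * f z) m c = a * cell_incr f m c"
  by (simp add: cell_incr_def algebra_simps)

section \<open>The Cameron-Martin density of the strip translation\<close>

context brownian_sheet_space
begin

text \<open>The density of the law of the sheet translated by \<open>\<theta>\<close> times the strip area in every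
  component; the sum is the mass that the sheet gives to the strip.\<close>

definition strip_weight :: "real \<Rightarrow> nat \<Rightarrow> 'w \<Rightarrow> ennreal" where
  "strip_weight \<theta> n \<omega> = ennreal (exp (\<theta> * (\<Sum>i\<in>UNIV. W (1, 1) \<omega> $ i - rect_incr W i (1 / 2 ^ n) (1 / 2 ^ n) 1 1 \<omega>)
     - real CARD('d) * \<theta>\<^sup>2 * strip_area (1 / 2 ^ n) (1, 1) / 2))"

text \<open>The Gaussian parameter of a cell: multiplied by the cell variance
  \<open>(1 / 2 ^ m)\<^sup>2\<close> it gives the increment of \<open>\<theta>\<close> times the
  strip area.\<close>

definition tilt :: "real \<Rightarrow> nat \<Rightarrow> nat \<Rightarrow> nat \<times> nat \<Rightarrow> real" where
  "tilt \<theta> n m c = (if in_strip n m c then \<theta> else 0)"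

lemma tilt_variance:
  assumes "n \<le> m"
  shows "tilt \<theta> n m c * (1 / 2 ^ m)\<^sup>2 = \<theta> * cell_incr (strip_area (1 / 2 ^ n)) m c"
    and "(tilt \<theta> n m c)\<^sup>2 * (1 / 2 ^ m)\<^sup>2 = \<theta>\<^sup>2 * cell_incr (strip_area (1 / 2 ^ n)) m c"
  using assms by (auto simp: tilt_def cell_incr_strip_area)

lemma sum_tilt_variance:
  assumes "n \<le> m"
  shows "(\<Sum>c\<in>cells m. (tilt \<theta> n m c)\<^sup>2 * (1 / 2 ^ m)\<^sup>2) = \<theta>\<^sup>2 * strip_area (1 / 2 ^ n) (1, 1)"
proof -
  have "(\<Sum>c\<in>cells m. cell_incr (strip_area (1 / 2 ^ n)) m c) = strip_area (1 / 2 ^ n) (1, 1)"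
    unfolding cells_def by (subst sum_cell_incr) (simp_all add: strip_area_axis)
  then show ?thesis by (simp only: tilt_variance(2)[OF assms] sum_distrib_left[symmetric])
qed

text \<open>The weight depends on \<open>n\<close> alone, yet factors over the cells of every finer
  level \<open>m\<close>. This consistency lets one density serve all finite-dimensional laws. The
  linear parts add up to the mass of the whole square minus that of the inner one.\<close>

lemma strip_weight_eq_prod:
  assumes nm: "n \<le> m" and \<omega>: "\<omega> \<in> space M"
  shows "strip_weight \<theta> n \<omega> = (\<Prod>i\<in>UNIV. \<Prod>c\<in>cells m.
    ennreal (exp (tilt \<theta> n m c * sheet_incr m i c \<omega> - (tilt \<theta> n m c)\<^sup>2 * (1 / 2 ^ m)\<^sup>2 / 2)))"
proof -
  define N :: nat where "N = 2 ^ (m - n)"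
  have N: "N \<le> 2 ^ m" by (simp add: N_def)
  have pow: "(2::real) ^ m = 2 ^ n * 2 ^ (m - n)"
    using nm by (simp add: power_add[symmetric])
  have r: "real N / 2 ^ m = 1 / 2 ^ n"
    by (simp add: N_def pow)
  have total: "(\<Sum>c\<in>cells m. sheet_incr m i c \<omega>) = W (1, 1) \<omega> $ i" for i
    unfolding cells_def sheet_incr_def by (subst sum_cell_incr) (simp_all add: W_axes[OF \<omega>])
  have inner: "(\<Sum>c\<in>{N..<2 ^ m} \<times> {N..<2 ^ m}. sheet_incr m i c \<omega>) = rect_incr W i (1 / 2 ^ n) (1 / 2 ^ n) 1 1 \<omega>" for i
    unfolding sheet_incr_def by (subst sum_cell_incr[OF N N]) (simp add: r rect_incr_def)
  have lin: "(\<Sum>c\<in>cells m. tilt \<theta> n m c * sheet_incr m i c \<omega>)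
      = \<theta> * (W (1, 1) \<omega> $ i - rect_incr W i (1 / 2 ^ n) (1 / 2 ^ n) 1 1 \<omega>)" for i
  proof -
    have "(\<Sum>c\<in>cells m. tilt \<theta> n m c * sheet_incr m i c \<omega>)
        = \<theta> * (\<Sum>c\<in>cells m. if in_strip n m c then sheet_incr m i c \<omega> else 0)"
      unfolding sum_distrib_left by (rule sum.cong) (auto simp: tilt_def)
    then show ?thesis
      by (simp only: sum_in_strip[OF nm] total N_def[symmetric] inner)
  qed
  have "(\<Prod>i\<in>UNIV. \<Prod>c\<in>cells m. ennreal (exp (tilt \<theta> n m c * sheet_incr m i c \<omega> - (tilt \<theta> n m c)\<^sup>2 * (1 / 2 ^ m)\<^sup>2 / 2)))
      = ennreal (exp (\<Sum>i\<in>(UNIV :: 'd set). \<Sum>c\<in>cells m. tilt \<theta> n m c * sheet_incr m i c \<omega> - (tilt \<theta> n m c)\<^sup>2 * (1 / 2 ^ m)\<^sup>2 / 2))"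
    by (simp add: prod_ennreal exp_sum prod_nonneg)
  also have "(\<Sum>i\<in>(UNIV :: 'd set). \<Sum>c\<in>cells m. tilt \<theta> n m c * sheet_incr m i c \<omega> - (tilt \<theta> n m c)\<^sup>2 * (1 / 2 ^ m)\<^sup>2 / 2)
      = (\<Sum>i\<in>(UNIV :: 'd set). \<theta> * (W (1, 1) \<omega> $ i - rect_incr W i (1 / 2 ^ n) (1 / 2 ^ n) 1 1 \<omega>)
          - \<theta>\<^sup>2 * strip_area (1 / 2 ^ n) (1, 1) / 2)"
    by (simp only: sum_subtractf lin sum_divide_distrib[symmetric] sum_tilt_variance[OF nm])
  also have "\<dots> = \<theta> * (\<Sum>i\<in>UNIV. W (1, 1) \<omega> $ i - rect_incr W i (1 / 2 ^ n) (1 / 2 ^ n) 1 1 \<omega>)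
     - real CARD('d) * \<theta>\<^sup>2 * strip_area (1 / 2 ^ n) (1, 1) / 2"
    by (simp only: sum_subtractf sum_distrib_left[symmetric] sum_constant mult.assoc times_divide_eq_right)
  finally show ?thesis by (simp only: strip_weight_def)
qed

lemma strip_weight_measurable [measurable]: "strip_weight \<theta> n \<in> borel_measurable M"
proof -
  have r: "0 \<le> (1::real) / 2 ^ n" "(1::real) / 2 ^ n \<le> 1" by simp_all
  have [measurable]: "W (1, 1) \<in> borel_measurable M" "W (1, 1 / 2 ^ n) \<in> borel_measurable M"
    "W (1 / 2 ^ n, 1) \<in> borel_measurable M" "W (1 / 2 ^ n, 1 / 2 ^ n) \<in> borel_measurable M"
    using r by (intro W_measurable; simp add: unit_sq_def)+
  show ?thesis unfolding strip_weight_def rect_incr_def by measurable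
qed

text \<open>Level \<open>n\<close> already resolves the strip, so independence reduces the claim to
  single cells. The exponent is the squared Cameron-Martin norm and vanishes with the area of the
  strip.\<close>

lemma nn_integral_strip_weight_sq:
  "(\<integral>\<^sup>+\<omega>. strip_weight \<theta> n \<omega> ^ 2 \<partial>M) = ennreal (exp (real CARD('d) * \<theta>\<^sup>2 * strip_area (1 / 2 ^ n) (1, 1)))"
proof -
  have "(\<integral>\<^sup>+\<omega>. strip_weight \<theta> n \<omega> ^ 2 \<partial>M) = (\<integral>\<^sup>+\<omega>. (\<Prod>i\<in>UNIV. \<Prod>c\<in>cells n.
      ennreal (exp (tilt \<theta> n n c * sheet_incr n i c \<omega> - (tilt \<theta> n n c)\<^sup>2 * (1 / 2 ^ n)\<^sup>2 / 2)) ^ 2) \<partial>M)"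
    by (rule nn_integral_cong) (simp only: strip_weight_eq_prod[OF order_refl] prod_power_distrib)
  also have "\<dots> = (\<Prod>i\<in>(UNIV :: 'd set). \<Prod>c\<in>cells n. ennreal (exp ((tilt \<theta> n n c)\<^sup>2 * (1 / 2 ^ n)\<^sup>2)))"
  proof (subst nn_integral_prod_sheet_incr[where \<phi>="\<lambda>i c x. ennreal (exp (tilt \<theta> n n c * x - (tilt \<theta> n n c)\<^sup>2 * (1 / 2 ^ n)\<^sup>2 / 2)) ^ 2"])
    show "(\<Prod>i\<in>(UNIV :: 'd set). \<Prod>c\<in>cells n. \<integral>\<^sup>+\<omega>.
        ennreal (exp (tilt \<theta> n n c * sheet_incr n i c \<omega> - (tilt \<theta> n n c)\<^sup>2 * (1 / 2 ^ n)\<^sup>2 / 2)) ^ 2 \<partial>M)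
       = (\<Prod>i\<in>(UNIV :: 'd set). \<Prod>c\<in>cells n. ennreal (exp ((tilt \<theta> n n c)\<^sup>2 * (1 / 2 ^ n)\<^sup>2)))"
      by (intro prod.cong refl gaussian_tilt_second_moment sheet_incr_distributed) simp_all
  qed simp
  also have "\<dots> = ennreal (exp (\<Sum>i\<in>(UNIV :: 'd set). \<Sum>c\<in>cells n. (tilt \<theta> n n c)\<^sup>2 * (1 / 2 ^ n)\<^sup>2))"
    by (simp only: prod_ennreal exp_sum prod_nonneg exp_ge_zero finite_cells finite)
  also have "(\<Sum>i\<in>(UNIV :: 'd set). \<Sum>c\<in>cells n. (tilt \<theta> n n c)\<^sup>2 * (1 / 2 ^ n)\<^sup>2) = real CARD('d) * \<theta>\<^sup>2 * strip_area (1 / 2 ^ n) (1, 1)"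
    by (simp only: sum_tilt_variance[OF order_refl] sum_constant mult.assoc)
  finally show ?thesis .
qed

text \<open>Measurable rectangles determine the law, and on them both sides factor over components
  and cells into instances of \<open>gaussian_shift\<close> with standard deviation
  \<open>1 / 2 ^ m\<close>.\<close>

lemma distr_sheet_incr_shift:
  assumes nm: "n \<le> m"
  defines "N \<equiv> PiM (UNIV \<times> cells m) (\<lambda>_. borel :: real measure)"
  shows "distr M N (\<lambda>\<omega>. \<lambda>ic\<in>UNIV \<times> cells m. sheet_incr m (fst ic) (snd ic) \<omega> + tilt \<theta> n m (snd ic) * (1 / 2 ^ m)\<^sup>2)
    = distr (density M (strip_weight \<theta> n)) N (\<lambda>\<omega>. \<lambda>ic\<in>UNIV \<times> cells m. sheet_incr m (fst ic) (snd ic) \<omega>)"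
    (is "distr M N ?X = distr ?M' N ?Y")
proof -
  have incr [measurable]: "sheet_incr m i c \<in> borel_measurable M" if "c \<in> cells m" for i c
    using that by (rule sheet_incr_measurable)
  have X [measurable]: "?X \<in> M \<rightarrow>\<^sub>M N" and Y [measurable]: "?Y \<in> M \<rightarrow>\<^sub>M N"
    unfolding N_def by (intro measurable_restrict; auto intro!: borel_measurable_add incr)+
  have Y': "?Y \<in> ?M' \<rightarrow>\<^sub>M N"
    using Y by (simp only: measurable_cong_sets[OF sets_density refl])
  show ?thesis
  proof (rule measure_eqI_PiM_finite[of "(UNIV :: 'd set) \<times> cells m" _ "\<lambda>_. borel" _ "\<lambda>_. space N"])
    show "sets (distr M N ?X) = sets (PiM (UNIV \<times> cells m) (\<lambda>_. borel))"
      "sets (distr ?M' N ?Y) = sets (PiM (UNIV \<times> cells m) (\<lambda>_. borel))"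
      by (simp_all add: N_def)
    have "space N \<in> prod_algebra (UNIV \<times> cells m) (\<lambda>_. borel :: real measure)"
      using prod_algebraI_finite[of "(UNIV :: 'd set) \<times> cells m" "\<lambda>_. UNIV" "\<lambda>_. borel :: real measure"]
      by (simp add: N_def space_PiM)
    then show "range (\<lambda>_::nat. space N) \<subseteq> prod_algebra (UNIV \<times> cells m) (\<lambda>_. borel :: real measure)" by auto
    show "(\<Union>i::nat. space N) = space (PiM (UNIV \<times> cells m) (\<lambda>_. borel :: real measure))"
      by (simp add: N_def)
    show "emeasure (distr M N ?X) (space N) \<noteq> \<infinity>"
      using prob_space.emeasure_space_1[OF prob_space_distr[OF X]] by simp
    fix A :: "'d \<times> nat \<times> nat \<Rightarrow> real set" assume A: "\<And>ic. ic \<in> UNIV \<times> cells m \<Longrightarrow> A ic \<in> sets borel"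
    \<comment> \<open>Sets outside the index range are replaced by the empty set, so that the
      factors are measurable for all indices, as \<open>nn_integral_prod_sheet_incr\<close>
      demands.\<close>
    define A' where "A' ic = (if snd ic \<in> cells m then A ic else {})" for ic
    have A' [measurable]: "A' ic \<in> sets borel" for ic
      using A[of ic] by (cases ic) (auto simp: A'_def)
    have B: "Pi\<^sub>E (UNIV \<times> cells m) A \<in> sets N"
      unfolding N_def by (intro sets_PiM_I_finite) (use A in auto)
    have ind: "indicator (Pi\<^sub>E (UNIV \<times> cells m) A) (\<lambda>ic\<in>UNIV \<times> cells m. f ic)
        = (\<Prod>i\<in>UNIV. \<Prod>c\<in>cells m. indicator (A' (i, c)) (f (i, c)) :: ennreal)" for f
    proof -
      have "(\<Prod>i\<in>UNIV. \<Prod>c\<in>cells m. indicator (A' (i, c)) (f (i, c)) :: ennreal)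
          = (\<Prod>ic\<in>UNIV \<times> cells m. if f ic \<in> A ic then 1 else 0)"
        by (simp add: prod.cartesian_product A'_def indicator_def split_beta' of_bool_def cong: prod.cong)
      also have "\<dots> = (if \<forall>ic\<in>UNIV \<times> cells m. f ic \<in> A ic then 1 else 0)"
        by (cases "\<forall>ic\<in>UNIV \<times> cells m. f ic \<in> A ic") (auto intro!: prod.neutral prod_zero)
      finally show ?thesis by (auto simp: indicator_def PiE_iff)
    qed
    have "emeasure (distr M N ?X) (Pi\<^sub>E (UNIV \<times> cells m) A) = (\<integral>\<^sup>+x. indicator (Pi\<^sub>E (UNIV \<times> cells m) A) x \<partial>distr M N ?X)"
      using B by simp
    also have "\<dots> = (\<integral>\<^sup>+\<omega>. indicator (Pi\<^sub>E (UNIV \<times> cells m) A) (?X \<omega>) \<partial>M)"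
      using B by (intro nn_integral_distr X) simp
    also have "\<dots> = (\<integral>\<^sup>+\<omega>. (\<Prod>i\<in>UNIV. \<Prod>c\<in>cells m. indicator (A' (i, c)) (sheet_incr m i c \<omega> + tilt \<theta> n m c * (1 / 2 ^ m)\<^sup>2)) \<partial>M)"
      by (simp only: ind fst_conv snd_conv)
    also have "\<dots> = (\<Prod>i\<in>UNIV. \<Prod>c\<in>cells m. \<integral>\<^sup>+\<omega>. indicator (A' (i, c)) (sheet_incr m i c \<omega> + tilt \<theta> n m c * (1 / 2 ^ m)\<^sup>2) \<partial>M)"
      by (rule nn_integral_prod_sheet_incr[where \<phi>="\<lambda>i c x. indicator (A' (i, c)) (x + tilt \<theta> n m c * (1 / 2 ^ m)\<^sup>2)"]) measurable
    also have "\<dots> = (\<Prod>i\<in>UNIV. \<Prod>c\<in>cells m. \<integral>\<^sup>+\<omega>. indicator (A' (i, c)) (sheet_incr m i c \<omega>) *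
        ennreal (exp (tilt \<theta> n m c * sheet_incr m i c \<omega> - (tilt \<theta> n m c)\<^sup>2 * (1 / 2 ^ m)\<^sup>2 / 2)) \<partial>M)"
      by (intro prod.cong refl gaussian_shift sheet_incr_distributed) auto
    also have "\<dots> = (\<integral>\<^sup>+\<omega>. (\<Prod>i\<in>UNIV. \<Prod>c\<in>cells m. indicator (A' (i, c)) (sheet_incr m i c \<omega>) *
        ennreal (exp (tilt \<theta> n m c * sheet_incr m i c \<omega> - (tilt \<theta> n m c)\<^sup>2 * (1 / 2 ^ m)\<^sup>2 / 2))) \<partial>M)"
      by (rule nn_integral_prod_sheet_incr[symmetric, where \<phi>="\<lambda>i c x. indicator (A' (i, c)) x *
         ennreal (exp (tilt \<theta> n m c * x - (tilt \<theta> n m c)\<^sup>2 * (1 / 2 ^ m)\<^sup>2 / 2))"]) measurable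
    also have "\<dots> = (\<integral>\<^sup>+\<omega>. strip_weight \<theta> n \<omega> * indicator (Pi\<^sub>E (UNIV \<times> cells m) A) (?Y \<omega>) \<partial>M)"
      by (rule nn_integral_cong) (simp only: ind fst_conv snd_conv strip_weight_eq_prod[OF nm] prod.distrib mult.commute)
    also have "\<dots> = (\<integral>\<^sup>+\<omega>. indicator (Pi\<^sub>E (UNIV \<times> cells m) A) (?Y \<omega>) \<partial>?M')"
      by (rule nn_integral_density[symmetric, OF strip_weight_measurable measurable_compose[OF Y borel_measurable_indicator[OF B]]])
    also have "\<dots> = (\<integral>\<^sup>+x. indicator (Pi\<^sub>E (UNIV \<times> cells m) A) x \<partial>distr ?M' N ?Y)"
      using B by (intro nn_integral_distr[symmetric, OF Y']) simp
    also have "\<dots> = emeasure (distr ?M' N ?Y) (Pi\<^sub>E (UNIV \<times> cells m) A)"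
      using B by simp
    finally show "emeasure (distr M N ?X) (Pi\<^sub>E (UNIV \<times> cells m) A) = emeasure (distr ?M' N ?Y) (Pi\<^sub>E (UNIV \<times> cells m) A)" .
  qed simp
qed

lemma W_path_measurable:
  "(\<lambda>\<omega>. \<lambda>z\<in>dyadic_points. W z \<omega> + vec (k z)) \<in> M \<rightarrow>\<^sub>M PiM dyadic_points (\<lambda>_. borel)"
  using dyadic_points_subset by (intro measurable_restrict borel_measurable_add W_measurable) auto

text \<open>It suffices to compare cylinder sets. Finitely many dyadic points lie in one grid of
  level at least \<open>n\<close>, where sheet and translated sheet are the same function,
  \<open>cell_sum\<close>, of their increments; the identity is then inherited from
  \<open>distr_sheet_incr_shift\<close>.\<close>

lemma distr_sheet_shift:
  defines "P \<equiv> PiM dyadic_points (\<lambda>_. borel :: (real ^ 'd) measure)"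
  shows "distr M P (\<lambda>\<omega>. \<lambda>z\<in>dyadic_points. W z \<omega> + vec (\<theta> * strip_area (1 / 2 ^ n) z))
    = distr (density M (strip_weight \<theta> n)) P (\<lambda>\<omega>. \<lambda>z\<in>dyadic_points. W z \<omega>)"
    (is "distr M P ?T = distr ?M' P ?S")
proof (rule measure_eqI_PiM_infinite[of _ dyadic_points "\<lambda>_. borel"])
  have T: "?T \<in> M \<rightarrow>\<^sub>M P"
    unfolding P_def by (rule W_path_measurable)
  have "?S \<in> M \<rightarrow>\<^sub>M P"
    using W_path_measurable[of "\<lambda>_. 0"] by (simp add: P_def cong: restrict_cong)
  then have S: "?S \<in> ?M' \<rightarrow>\<^sub>M P"
    by (simp only: measurable_cong_sets[OF sets_density refl])
  show "sets (distr M P ?T) = sets (PiM dyadic_points (\<lambda>_. borel))"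
    "sets (distr ?M' P ?S) = sets (PiM dyadic_points (\<lambda>_. borel))"
    by (simp_all add: P_def)
  show "finite_measure (distr M P ?T)"
    using prob_space_distr[OF T] by (rule prob_space.finite_measure)
  fix A :: "real \<times> real \<Rightarrow> (real ^ 'd) set" and J :: "(real \<times> real) set"
  assume J: "finite J" "J \<subseteq> dyadic_points" and A: "\<And>z. z \<in> J \<Longrightarrow> A z \<in> sets borel"
  let ?E = "prod_emb dyadic_points (\<lambda>_. borel :: (real ^ 'd) measure) J (Pi\<^sub>E J A)"
  obtain m where nm: "n \<le> m" and Jm: "J \<subseteq> dyadic_grid m"
    using finite_dyadic_points_subset_grid[OF J] by blast
  define N where "N = PiM ((UNIV :: 'd set) \<times> cells m) (\<lambda>_. borel :: real measure)"
  let ?X = "\<lambda>\<omega>. \<lambda>ic\<in>UNIV \<times> cells m. sheet_incr m (fst ic) (snd ic) \<omega> + tilt \<theta> n m (snd ic) * (1 / 2 ^ m)\<^sup>2"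
  let ?Y = "\<lambda>\<omega>. \<lambda>ic\<in>UNIV \<times> cells m. sheet_incr m (fst ic) (snd ic) \<omega>"
  define B where "B = {x \<in> space N. \<forall>z\<in>J. cell_sum m x z \<in> A z}"
  have X: "?X \<in> M \<rightarrow>\<^sub>M N" and Y: "?Y \<in> M \<rightarrow>\<^sub>M N"
    unfolding N_def by (intro measurable_restrict; auto intro!: borel_measurable_add sheet_incr_measurable)+
  have Y': "?Y \<in> ?M' \<rightarrow>\<^sub>M N"
    using Y by (simp only: measurable_cong_sets[OF sets_density refl])
  have cs: "(\<lambda>x. cell_sum m x z) \<in> borel_measurable N" for z
  proof (rule borel_measurable_vecI)
    fix i
    show "(\<lambda>x. cell_sum m x z $ i) \<in> borel_measurable N"
      unfolding cell_sum_def vec_lambda_beta N_def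
      by (intro borel_measurable_sum measurable_component_singleton) auto
  qed
  have B: "B \<in> sets N"
    unfolding B_def
  proof (rule sets.sets_Collect_finite_All[OF _ J(1)])
    show "{x \<in> space N. cell_sum m x z \<in> A z} \<in> sets N" if "z \<in> J" for z
      using measurable_sets[OF cs A[OF that], of z] by (simp add: vimage_def Int_def conj_commute)
  qed
  have E: "?E \<in> sets P"
    unfolding P_def using J A by (intro sets_PiM_I) auto
  have preX: "?T -` ?E \<inter> space M = ?X -` B \<inter> space M"
  proof -
    have "?T \<omega> \<in> ?E \<longleftrightarrow> ?X \<omega> \<in> B" if \<omega>: "\<omega> \<in> space M" for \<omega>
    proof -
      have "cell_sum m (?X \<omega>) z = W z \<omega> + vec (\<theta> * strip_area (1 / 2 ^ n) z)" if z: "z \<in> J" for z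
      proof (rule cell_sum_cell_incr)
        show "z \<in> dyadic_grid m" using z Jm by auto
        show "?X \<omega> (i, c) = cell_incr (\<lambda>z. (W z \<omega> + vec (\<theta> * strip_area (1 / 2 ^ n) z)) $ i) m c"
          if "c \<in> cells m" for i c
          using that tilt_variance(1)[OF nm, of \<theta> c]
          by (simp add: cell_incr_add cell_incr_cmult sheet_incr_def)
      qed (simp_all add: W_axes[OF \<omega>] strip_area_axis)
      moreover have "?X \<omega> \<in> space N" using measurable_space[OF X \<omega>] .
      ultimately show ?thesis using J(2) by (auto simp: B_def prod_emb_def PiE_iff)
    qed
    then show ?thesis by auto
  qed
  have preY: "?S -` ?E \<inter> space ?M' = ?Y -` B \<inter> space ?M'"
  proof -
    have "?S \<omega> \<in> ?E \<longleftrightarrow> ?Y \<omega> \<in> B" if \<omega>: "\<omega> \<in> space M" for \<omega>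
    proof -
      have "cell_sum m (?Y \<omega>) z = W z \<omega>" if z: "z \<in> J" for z
      proof (rule cell_sum_cell_incr)
        show "z \<in> dyadic_grid m" using z Jm by auto
      qed (simp_all add: W_axes[OF \<omega>] sheet_incr_def)
      moreover have "?Y \<omega> \<in> space N" using measurable_space[OF Y \<omega>] .
      ultimately show ?thesis using J(2) by (auto simp: B_def prod_emb_def PiE_iff)
    qed
    then show ?thesis by auto
  qed
  have "emeasure (distr M P ?T) ?E = emeasure (distr M N ?X) B"
    by (simp only: emeasure_distr[OF T E] emeasure_distr[OF X B] preX)
  also have "\<dots> = emeasure (distr ?M' N ?Y) B"
    unfolding N_def by (simp only: distr_sheet_incr_shift[OF nm])
  also have "\<dots> = emeasure (distr ?M' P ?S) ?E"
    by (simp only: emeasure_distr[OF S E] emeasure_distr[OF Y' B] preY)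
  finally show "emeasure (distr M P ?T) ?E = emeasure (distr ?M' P ?S) ?E" .
qed

end

section \<open>Bounded drifts\<close>

lemma continuous_on_box_integral:
  fixes g :: "real \<times> real \<Rightarrow> real ^ 'd"
  assumes "g \<in> borel_measurable borel" "\<And>p i. \<bar>g p $ i\<bar> \<le> B"
  shows "continuous_on unit_sq (box_integral g)"
  unfolding box_integral_def[abs_def]
  using assms by (intro continuous_on_vec_lambda continuous_box_integral[of _ B] borel_measurable_vec_nth) auto

context monotone_drift
begin

lemma continuous_on_upper_sol:
  assumes [measurable]: "w \<in> borel_measurable borel" and w: "continuous_on unit_sq w"
  shows "continuous_on unit_sq (upper_sol \<beta> C w)"
proof -
  have "continuous_on unit_sq (\<lambda>z. box_integral (\<lambda>p. upper_drift \<beta> p (upper_sol \<beta> C w p)) z + w z)"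
    using upper_drift_sol_measurable[OF assms(1)] monotone_drift.drift_bound[OF monotone_drift_upper]
    by (intro continuous_on_add w continuous_on_box_integral[where B=C]) auto
  then show ?thesis
    by (rule continuous_on_eq) (rule upper_sol_eq[OF assms(1), symmetric]; simp add: unit_sq_def mem_Times_iff)
qed

end

lemma continuous_on_lower_sol:
  assumes "monotone_drift \<beta> C" "w \<in> borel_measurable borel" "continuous_on unit_sq w"
  shows "continuous_on unit_sq (lower_sol \<beta> C w)"
  unfolding lower_sol_def[abs_def]
  by (intro continuous_on_minus monotone_drift.continuous_on_upper_sol monotone_drift.monotone_drift_reflect
      borel_measurable_uminus assms)

lemma dyadic_extend_measurable_path:
  assumes "e \<in> space (PiM dyadic_points (\<lambda>_. borel :: (real ^ 'd) measure))"
  shows "dyadic_extend e \<in> borel_measurable borel"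
proof -
  have "(\<lambda>z. (e, z)) \<in> borel \<rightarrow>\<^sub>M PiM dyadic_points (\<lambda>_. borel :: (real ^ 'd) measure) \<Otimes>\<^sub>M borel"
    using assms by measurable
  from measurable_compose[OF this dyadic_extend_measurable] show ?thesis by simp
qed

lemma strip_area_tendsto_0: "(\<lambda>n. strip_area (1 / 2 ^ n) (1, 1)) \<longlonglongrightarrow> 0"
proof -
  have "(\<lambda>n. 1 * 1 - max (1 - (1 / 2) ^ n) 0 * max (1 - (1 / 2) ^ n) 0) \<longlonglongrightarrow> 1 * 1 - max (1 - 0) 0 * max (1 - 0) (0::real)"
    by (intro tendsto_intros tendsto_max LIMSEQ_power_zero) auto
  then show ?thesis by (simp add: strip_area_def power_one_over)
qed

section \<open>Convergence of the translated laws and almost sure equality\<close>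

context brownian_sheet_space
begin

definition strip_density :: "real \<Rightarrow> nat \<Rightarrow> 'w \<Rightarrow> real" where
  "strip_density \<theta> n \<omega> = enn2real (strip_weight \<theta> n \<omega>)"

lemma strip_weight_eq_density: "strip_weight \<theta> n \<omega> = ennreal (strip_density \<theta> n \<omega>)"
  by (simp add: strip_density_def strip_weight_def)

lemma strip_density_nonneg: "0 \<le> strip_density \<theta> n \<omega>"
  by (simp add: strip_density_def)

lemma strip_density_measurable [measurable]: "strip_density \<theta> n \<in> borel_measurable M"
  unfolding strip_density_def[abs_def] by measurable

text \<open>The density \<open>R\<close> has mean one since the translated law is a probability
  measure. Nonnegativity of the variance of \<open>\<bar>R - 1\<bar>\<close> then bounds its squared
  mean by \<open>E (R - 1)^2 = E R^2 - 1\<close>.\<close>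

lemma strip_density_L1:
  "expectation (\<lambda>\<omega>. \<bar>strip_density \<theta> n \<omega> - 1\<bar>)
    \<le> sqrt (exp (real CARD('d) * \<theta>\<^sup>2 * strip_area (1 / 2 ^ n) (1, 1)) - 1)"
  "integrable M (strip_density \<theta> n)"
proof -
  let ?P = "PiM dyadic_points (\<lambda>_. borel :: (real ^ 'd) measure)"
  let ?T = "\<lambda>\<omega>. \<lambda>z\<in>dyadic_points. W z \<omega> + vec (\<theta> * strip_area (1 / 2 ^ n) z)"
  let ?S = "\<lambda>\<omega>. \<lambda>z\<in>dyadic_points. W z \<omega>"
  let ?R = "strip_density \<theta> n"
  let ?v = "real CARD('d) * \<theta>\<^sup>2 * strip_area (1 / 2 ^ n) (1, 1)"
  have T: "?T \<in> M \<rightarrow>\<^sub>M ?P" by (rule W_path_measurable)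
  have S: "?S \<in> density M (strip_weight \<theta> n) \<rightarrow>\<^sub>M ?P"
    using W_path_measurable[of "\<lambda>_. 0"] by (simp add: measurable_cong_sets[OF sets_density refl] cong: restrict_cong)
  have "1 = emeasure (distr M ?P ?T) (space ?P)"
    using prob_space.emeasure_space_1[OF prob_space_distr[OF T]] by simp
  also have "\<dots> = emeasure (distr (density M (strip_weight \<theta> n)) ?P ?S) (space ?P)"
    by (simp only: distr_sheet_shift)
  also have "\<dots> = emeasure (density M (strip_weight \<theta> n)) (space M)"
    using measurable_space[OF S] by (subst emeasure_distr[OF S]) (auto intro!: arg_cong2[where f=emeasure])
  also have "\<dots> = (\<integral>\<^sup>+\<omega>. strip_weight \<theta> n \<omega> \<partial>M)"
    by (subst emeasure_density) (auto intro!: nn_integral_cong)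
  finally have nn1: "(\<integral>\<^sup>+\<omega>. ennreal (?R \<omega>) \<partial>M) = ennreal 1"
    by (simp add: strip_weight_eq_density)
  have nn2: "(\<integral>\<^sup>+\<omega>. ennreal ((?R \<omega>)\<^sup>2) \<partial>M) = ennreal (exp ?v)"
    using nn_integral_strip_weight_sq[of \<theta> n]
    by (simp add: strip_weight_eq_density ennreal_power strip_density_nonneg)
  note R1 = nn_integral_eq_integrable[THEN iffD1, OF _ _ _ nn1]
  note R2 = nn_integral_eq_integrable[THEN iffD1, OF _ _ _ nn2]
  have int1: "integrable M ?R" and E1: "expectation ?R = 1"
    using R1 by (auto simp: strip_density_nonneg)
  have int2: "integrable M (\<lambda>\<omega>. (?R \<omega>)\<^sup>2)" and E2: "expectation (\<lambda>\<omega>. (?R \<omega>)\<^sup>2) = exp ?v"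
    using R2 by auto
  show "integrable M ?R" by (rule int1)
  have sq: "(\<lambda>\<omega>. \<bar>?R \<omega> - 1\<bar>\<^sup>2) = (\<lambda>\<omega>. (?R \<omega>)\<^sup>2 - 2 * ?R \<omega> + 1)"
    by (simp add: fun_eq_iff power2_diff)
  have "integrable M (\<lambda>\<omega>. \<bar>?R \<omega> - 1\<bar>\<^sup>2)" "expectation (\<lambda>\<omega>. \<bar>?R \<omega> - 1\<bar>\<^sup>2) = exp ?v - 1"
    unfolding sq using int1 int2 by (simp_all add: E1 E2 prob_space)
  then have "(expectation (\<lambda>\<omega>. \<bar>?R \<omega> - 1\<bar>))\<^sup>2 \<le> exp ?v - 1"
    using variance_eq[of "\<lambda>\<omega>. \<bar>?R \<omega> - 1\<bar>"] variance_positive[of "\<lambda>\<omega>. \<bar>?R \<omega> - 1\<bar>"] int1 by simp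
  then show "expectation (\<lambda>\<omega>. \<bar>?R \<omega> - 1\<bar>) \<le> sqrt (exp ?v - 1)"
    by (rule real_le_rsqrt)
qed

text \<open>On the square this is \<open>W\<close>; off the square it remains Borel, and it depends
  on the sample only through the dyadic values, whose law is under control.\<close>

definition sheet_path :: "'w \<Rightarrow> real \<times> real \<Rightarrow> real ^ 'd" where
  "sheet_path \<omega> = dyadic_extend (\<lambda>z\<in>dyadic_points. W z \<omega>)"

lemma sheet_path_eq: "\<omega> \<in> space M \<Longrightarrow> z \<in> unit_sq \<Longrightarrow> sheet_path \<omega> z = W z \<omega>"
  unfolding sheet_path_def by (rule dyadic_extend_eq[OF W_continuous]) auto

lemma sheet_restrict_measurable: "(\<lambda>\<omega>. \<lambda>z\<in>dyadic_points. W z \<omega>) \<in> M \<rightarrow>\<^sub>M PiM dyadic_points (\<lambda>_. borel)"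
  using W_path_measurable[of "\<lambda>_. 0"] by (simp cong: restrict_cong)

lemma sheet_path_measurable: "\<omega> \<in> space M \<Longrightarrow> sheet_path \<omega> \<in> borel_measurable borel"
  unfolding sheet_path_def by (rule dyadic_extend_measurable_path[OF measurable_space[OF sheet_restrict_measurable]])

lemma sheet_path_continuous: "\<omega> \<in> space M \<Longrightarrow> continuous_on unit_sq (sheet_path \<omega>)"
  by (rule continuous_on_eq[OF W_continuous]) (simp_all add: sheet_path_eq)

text \<open>With \<open>R\<close> the density for strip \<open>n\<close>, comparison and change of
  measure give \<open>E U(S) \<le> E L(T n) = E (R * L(S))\<close>. Hence
  \<open>E (U(S) - L(S))\<close> is at most \<open>pi / 2 * E \<bar>R - 1\<bar>\<close>, which tends
  to \<open>0\<close>, while the integrand is nonnegative.\<close>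

lemma upper_sol_eq_lower_sol_AE_point:
  assumes "monotone_drift \<beta> C" and C: "0 < C" and z: "z \<in> dyadic_points"
  shows "AE \<omega> in M. upper_sol \<beta> C (sheet_path \<omega>) z $ i = lower_sol \<beta> C (sheet_path \<omega>) z $ i"
proof -
  interpret monotone_drift \<beta> C by fact
  let ?P = "PiM dyadic_points (\<lambda>_. borel :: (real ^ 'd) measure)"
  let ?T = "\<lambda>n \<omega>. \<lambda>z\<in>dyadic_points. W z \<omega> + vec (3 * C * strip_area (1 / 2 ^ n) z)"
  let ?S = "\<lambda>\<omega>. \<lambda>z\<in>dyadic_points. W z \<omega>"
  have zu: "z \<in> unit_sq" using z dyadic_points_subset by auto
  define U where "U e = arctan (upper_sol \<beta> C (dyadic_extend e) z $ i)" for e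
  define L where "L e = arctan (lower_sol \<beta> C (dyadic_extend e) z $ i)" for e
  have pair: "(\<lambda>e. (e, z)) \<in> ?P \<rightarrow>\<^sub>M ?P \<Otimes>\<^sub>M borel" by measurable
  have [measurable]: "U \<in> borel_measurable ?P"
    using measurable_compose[OF pair upper_sol_measurable_param[OF dyadic_extend_measurable]]
    unfolding U_def by simp
  have L_meas [measurable]: "L \<in> borel_measurable ?P"
    using measurable_compose[OF pair lower_sol_measurable_param[OF dyadic_extend_measurable]]
    unfolding L_def by simp
  note S [measurable] = sheet_restrict_measurable
  have T [measurable]: "?T n \<in> M \<rightarrow>\<^sub>M ?P" for n by (rule W_path_measurable)
  have "\<bar>arctan x\<bar> \<le> pi / 2" for x
    using arctan_lbound[of x] arctan_ubound[of x] by linarith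
  then have bnd: "\<bar>U e\<bar> \<le> pi / 2" "\<bar>L e\<bar> \<le> pi / 2" for e
    unfolding U_def L_def by blast+
  have int: "integrable M f" if "f \<in> borel_measurable M" "\<And>\<omega>. \<bar>f \<omega>\<bar> \<le> pi / 2" for f :: "'w \<Rightarrow> real"
    by (rule integrable_const_bound[of _ "pi / 2"]) (simp_all only: that real_norm_def AE_I2)
  have intU: "integrable M (\<lambda>\<omega>. U (?S \<omega>))" and intL: "integrable M (\<lambda>\<omega>. L (?S \<omega>))"
    and intLT: "integrable M (\<lambda>\<omega>. L (?T n \<omega>))" for n
    by (rule int[OF _ bnd(1)] int[OF _ bnd(2)], measurable)+
  have le: "U (?S \<omega>) \<le> L (?T n \<omega>)" if \<omega>: "\<omega> \<in> space M" for n \<omega>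
    unfolding U_def L_def
  proof (intro arctan_monotone' upper_sol_le_lower_sol_shift[OF C, of "1 / 2 ^ n"] zu)
    show "dyadic_extend (?S \<omega>) \<in> borel_measurable borel" "dyadic_extend (?T n \<omega>) \<in> borel_measurable borel"
      using measurable_space[OF S \<omega>] measurable_space[OF T \<omega>, of n] by (simp_all only: dyadic_extend_measurable_path)
    fix y assume y: "y \<in> unit_sq"
    have "continuous_on unit_sq (\<lambda>z. W z \<omega> + vec (3 * C * strip_area (1 / 2 ^ n) z))"
      unfolding vec_def
      by (intro continuous_on_add W_continuous \<omega> continuous_on_vec_lambda continuous_on_mult continuous_on_const continuous_on_strip_area)
    then have "dyadic_extend (?T n \<omega>) y = W y \<omega> + vec (3 * C * strip_area (1 / 2 ^ n) y)"
      using y by (rule dyadic_extend_eq) auto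
    moreover have "dyadic_extend (?S \<omega>) y = W y \<omega>"
      using y by (rule dyadic_extend_eq[OF W_continuous[OF \<omega>]]) auto
    ultimately show "dyadic_extend (?T n \<omega>) y = dyadic_extend (?S \<omega>) y + vec (3 * C * strip_area (1 / 2 ^ n) y)"
      by simp
  qed simp
  define \<epsilon> where "\<epsilon> n = pi / 2 * sqrt (exp (real CARD('d) * (3 * C)\<^sup>2 * strip_area (1 / 2 ^ n) (1, 1)) - 1)" for n
  have bound: "expectation (\<lambda>\<omega>. U (?S \<omega>) - L (?S \<omega>)) \<le> \<epsilon> n" for n
  proof -
    let ?R = "strip_density (3 * C) n"
    note int_R = strip_density_L1(2)[of "3 * C" n]
    have int_RL: "integrable M (\<lambda>\<omega>. ?R \<omega> * L (?S \<omega>))"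
    proof (rule Bochner_Integration.integrable_bound[OF integrable_mult_left[OF int_R, of "pi / 2"]])
      show "AE \<omega> in M. norm (?R \<omega> * L (?S \<omega>)) \<le> norm (?R \<omega> * (pi / 2))"
        unfolding real_norm_def abs_mult
        using bnd(2) by (intro AE_I2 mult_left_mono) (auto intro: order_trans[OF _ abs_ge_self])
    qed measurable
    have "expectation (\<lambda>\<omega>. U (?S \<omega>)) \<le> expectation (\<lambda>\<omega>. L (?T n \<omega>))"
      by (rule integral_mono[OF intU intLT le])
    also have "\<dots> = integral\<^sup>L (distr M ?P (?T n)) L"
      by (rule integral_distr[symmetric, OF T]) measurable
    also have "\<dots> = integral\<^sup>L (distr (density M (\<lambda>\<omega>. ennreal (?R \<omega>))) ?P ?S) L"
      by (simp only: distr_sheet_shift strip_weight_eq_density[abs_def])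
    also have "\<dots> = integral\<^sup>L (density M (\<lambda>\<omega>. ennreal (?R \<omega>))) (\<lambda>\<omega>. L (?S \<omega>))"
      using S by (intro integral_distr) (simp_all only: measurable_cong_sets[OF sets_density refl], measurable)
    also have "\<dots> = expectation (\<lambda>\<omega>. ?R \<omega> * L (?S \<omega>))"
      by (rule integral_real_density) (rule measurable_compose[OF S L_meas] strip_density_measurable AE_I2 strip_density_nonneg)+
    finally have "expectation (\<lambda>\<omega>. U (?S \<omega>) - L (?S \<omega>)) \<le> expectation (\<lambda>\<omega>. (?R \<omega> - 1) * L (?S \<omega>))"
      using intU intL int_RL by (simp add: left_diff_distrib)
    also have "\<dots> \<le> expectation (\<lambda>\<omega>. pi / 2 * \<bar>?R \<omega> - 1\<bar>)"
    proof (rule integral_mono)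
      show "integrable M (\<lambda>\<omega>. (?R \<omega> - 1) * L (?S \<omega>))"
        using int_RL intL by (simp add: left_diff_distrib)
      show "integrable M (\<lambda>\<omega>. pi / 2 * \<bar>?R \<omega> - 1\<bar>)" using int_R by simp
      show "(?R \<omega> - 1) * L (?S \<omega>) \<le> pi / 2 * \<bar>?R \<omega> - 1\<bar>" for \<omega>
      proof -
        have "(?R \<omega> - 1) * L (?S \<omega>) \<le> \<bar>(?R \<omega> - 1) * L (?S \<omega>)\<bar>" by (rule abs_ge_self)
        also have "\<dots> = \<bar>?R \<omega> - 1\<bar> * \<bar>L (?S \<omega>)\<bar>" by (rule abs_mult)
        also have "\<dots> \<le> \<bar>?R \<omega> - 1\<bar> * (pi / 2)" using bnd by (intro mult_left_mono) auto
        finally show ?thesis by (simp add: mult.commute)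
      qed
    qed
    also have "\<dots> \<le> \<epsilon> n"
      using strip_density_L1(1)[of "3 * C" n] by (simp add: \<epsilon>_def)
    finally show ?thesis .
  qed
  have "\<epsilon> \<longlonglongrightarrow> pi / 2 * sqrt (exp (real CARD('d) * (3 * C)\<^sup>2 * 0) - 1)"
    unfolding \<epsilon>_def by (intro tendsto_intros strip_area_tendsto_0)
  then have "expectation (\<lambda>\<omega>. U (?S \<omega>) - L (?S \<omega>)) \<le> 0"
    using bound by (intro LIMSEQ_le_const[of \<epsilon> 0]) auto
  moreover have nonneg: "0 \<le> U (?S \<omega>) - L (?S \<omega>)" if "\<omega> \<in> space M" for \<omega>
    using lower_sol_le_upper_sol[OF sheet_path_measurable[OF that] zu, of i]
    unfolding U_def L_def sheet_path_def by (simp add: arctan_le_iff)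
  ultimately have "expectation (\<lambda>\<omega>. U (?S \<omega>) - L (?S \<omega>)) = 0"
    by (intro antisym integral_nonneg_AE AE_I2) auto
  then have "AE \<omega> in M. U (?S \<omega>) - L (?S \<omega>) = 0"
    using integral_nonneg_eq_0_iff_AE[of M "\<lambda>\<omega>. U (?S \<omega>) - L (?S \<omega>)"] intU intL nonneg by auto
  then show ?thesis
    by eventually_elim (simp add: U_def L_def sheet_path_def arctan_eq_iff)
qed

lemma upper_sol_eq_lower_sol_AE:
  assumes \<beta>: "monotone_drift \<beta> C" and C: "0 < C"
  shows "AE \<omega> in M. \<forall>z\<in>unit_sq. upper_sol \<beta> C (sheet_path \<omega>) z = lower_sol \<beta> C (sheet_path \<omega>) z"
proof -
  have "AE \<omega> in M. \<forall>z\<in>dyadic_points. \<forall>i\<in>UNIV. upper_sol \<beta> C (sheet_path \<omega>) z $ i = lower_sol \<beta> C (sheet_path \<omega>) z $ i"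
    by (intro AE_ball_countable'[OF _ countable_dyadic_points] AE_finite_allI upper_sol_eq_lower_sol_AE_point assms) auto
  with AE_space show ?thesis
  proof eventually_elim
    case (elim \<omega>)
    show ?case
    proof
      fix z assume z: "z \<in> unit_sq"
      let ?D = "\<lambda>z. upper_sol \<beta> C (sheet_path \<omega>) z - lower_sol \<beta> C (sheet_path \<omega>) z"
      have "continuous_on unit_sq ?D"
        using elim by (intro continuous_on_diff monotone_drift.continuous_on_upper_sol[OF \<beta>] continuous_on_lower_sol[OF \<beta>]
            sheet_path_measurable sheet_path_continuous) auto
      \<comment> \<open>A continuous function vanishing at all dyadic points agrees on the square
        with the extension of \<open>0\<close>, so the exceptional null set no longer depends on
        \<open>z\<close>.\<close>
      then have "dyadic_extend (\<lambda>_. 0) z = ?D z"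
        using z by (rule dyadic_extend_eq) (use elim in \<open>auto simp: vec_eq_iff\<close>)
      moreover have "dyadic_extend (\<lambda>_. 0 :: real ^ 'd) z = 0"
        by (simp add: dyadic_extend_def)
      ultimately show "upper_sol \<beta> C (sheet_path \<omega>) z = lower_sol \<beta> C (sheet_path \<omega>) z" by simp
    qed
  qed
qed

text \<open>Competitors are restricted only through measurability of the composed drift, so their
  values off the square do not matter when the drift vanishes there.\<close>

lemma bounded_drift_unique_solution_AE:
  assumes \<beta>: "monotone_drift \<beta> C" and C: "0 < C"
  shows "AE \<omega> in M. \<exists>X \<in> borel_measurable borel. continuous_on unit_sq X \<and>
    (\<forall>z\<in>unit_sq. X z = box_integral (\<lambda>p. \<beta> p (X p)) z + W z \<omega>) \<and>
    (\<forall>Y. (\<lambda>p. \<beta> p (Y p)) \<in> borel_measurable borel \<longrightarrow>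
      (\<forall>z\<in>unit_sq. Y z = box_integral (\<lambda>p. \<beta> p (Y p)) z + W z \<omega>) \<longrightarrow> (\<forall>z\<in>unit_sq. Y z = X z))"
  using upper_sol_eq_lower_sol_AE[OF assms] AE_space
proof eventually_elim
  case (elim \<omega>)
  interpret monotone_drift \<beta> C by fact
  note pm = sheet_path_measurable[OF elim(2)]
  note uniq = unique_solution_of_upper_eq_lower[OF pm]
  show ?case
  proof (intro bexI[of _ "upper_sol \<beta> C (sheet_path \<omega>)"] conjI ballI allI impI)
    show "upper_sol \<beta> C (sheet_path \<omega>) \<in> borel_measurable borel"
      by (rule upper_sol_measurable[OF pm])
    show "continuous_on unit_sq (upper_sol \<beta> C (sheet_path \<omega>))"
      by (rule continuous_on_upper_sol[OF pm sheet_path_continuous[OF elim(2)]])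
    show "upper_sol \<beta> C (sheet_path \<omega>) z = box_integral (\<lambda>p. \<beta> p (upper_sol \<beta> C (sheet_path \<omega>) p)) z + W z \<omega>"
      if "z \<in> unit_sq" for z
      using uniq(1)[of z] elim that by (simp add: sheet_path_eq)
    show "Y z = upper_sol \<beta> C (sheet_path \<omega>) z"
      if "(\<lambda>p. \<beta> p (Y p)) \<in> borel_measurable borel"
        "\<forall>z\<in>unit_sq. Y z = box_integral (\<lambda>p. \<beta> p (Y p)) z + W z \<omega>" "z \<in> unit_sq" for Y z
      using elim that by (intro uniq(2)) (simp_all add: sheet_path_eq)
  qed
qed

end

section \<open>Drifts of linear growth\<close>

lemma set_integrable_box_vec:
  fixes g :: "real \<times> real \<Rightarrow> real ^ 'd"
  assumes [measurable]: "g \<in> borel_measurable borel" and "\<And>p i. \<bar>g p $ i\<bar> \<le> B"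
  shows "set_integrable lborel (cbox a z) g"
proof -
  have g: "norm (g p) \<le> real CARD('d) * B" for p
  proof -
    have "norm (g p) \<le> (\<Sum>i\<in>UNIV. \<bar>g p $ i\<bar>)" by (rule norm_le_l1_cart)
    also have "\<dots> \<le> (\<Sum>i\<in>(UNIV :: 'd set). B)" by (rule sum_mono) (rule assms(2))
    finally show ?thesis by simp
  qed
  have "integrable lborel (\<lambda>p. indicat_real (cbox a z) p *\<^sub>R norm (g p))"
    using set_integrable_box[of "\<lambda>p. norm (g p)" "real CARD('d) * B" a z] g by (simp add: set_integrable_def)
  then show ?thesis
    unfolding set_integrable_def by (rule Bochner_Integration.integrable_bound) (simp_all add: indicator_def)
qed

lemma box_integral_eq_set_integral:
  fixes g :: "real \<times> real \<Rightarrow> real ^ 'd"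
  assumes "set_integrable lborel (cbox 0 z) g"
  shows "box_integral g z = (LINT p:cbox 0 z|lborel. g p)"
proof (rule vec_eq_iff[THEN iffD2], rule allI)
  fix i
  show "box_integral g z $ i = (LINT p:cbox 0 z|lborel. g p) $ i"
    using integral_bounded_linear[OF bounded_linear_vec_nth, of lborel "\<lambda>p. indicat_real (cbox 0 z) p *\<^sub>R g p" i] assms
    by (simp add: box_integral_nth set_lebesgue_integral_def set_integrable_def)
qed

lemma set_integral_box_iterated:
  fixes g :: "real \<times> real \<Rightarrow> 'b :: {banach, second_countable_topology}"
  assumes "set_integrable lborel (cbox 0 (s, t)) g"
  shows "(LINT p:cbox 0 (s, t)|lborel. g p) = (LINT \<zeta>:{0..t}|lborel. LINT \<xi>:{0..s}|lborel. g (\<xi>, \<zeta>))"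
proof -
  let ?f = "\<lambda>\<xi> \<zeta>. indicat_real (cbox 0 (s, t)) (\<xi>, \<zeta>) *\<^sub>R g (\<xi>, \<zeta>)"
  have "integrable (lborel \<Otimes>\<^sub>M lborel) (case_prod ?f)"
    using assms by (simp add: set_integrable_def lborel_prod split_beta')
  from lborel_pair.integral_snd[OF this]
  have "(LINT p:cbox 0 (s, t)|lborel. g p) = (LINT \<zeta>|lborel. LINT \<xi>|lborel. ?f \<xi> \<zeta>)"
    by (simp add: set_lebesgue_integral_def lborel_prod split_beta')
  moreover have "?f \<xi> \<zeta> = indicat_real {0..t} \<zeta> *\<^sub>R (indicat_real {0..s} \<xi> *\<^sub>R g (\<xi>, \<zeta>))" for \<xi> \<zeta>
    by (auto simp: indicator_def mem_cbox_0)
  ultimately show ?thesis by (simp only: set_lebesgue_integral_def integral_scaleR_right)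
qed

lemma set_integral_exp:
  fixes l s :: real
  assumes "0 < l" "0 \<le> s"
  shows "(LINT \<xi>:{0..s}|lborel. exp (l * \<xi>)) = (exp (l * s) - 1) / l"
proof -
  have "(LINT \<xi>:{0..s}|lborel. exp (l * \<xi>)) = exp (l * s) / l - exp (l * 0) / l"
    unfolding set_lebesgue_integral_def
    by (rule integral_FTC_atLeastAtMost[OF assms(2)])
       (use assms(1) in \<open>auto intro!: derivative_eq_intros continuous_intros simp: has_real_derivative_iff_has_vector_derivative[symmetric]\<close>)
  then show ?thesis by (simp add: diff_divide_distrib)
qed

text \<open>Gronwall's inequality: maximise \<open>norm (Y z) * exp (- l * fst z)\<close> with \<open>l > 2 * K\<close>.\<close>

lemma linear_growth_bound:
  fixes Y g w :: "real \<times> real \<Rightarrow> real ^ 'd"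
  assumes Y_cont: "continuous_on unit_sq Y"
    and g: "g \<in> borel_measurable borel" "\<And>p i. \<bar>g p $ i\<bar> \<le> B"
    and growth: "\<And>p. p \<in> unit_sq \<Longrightarrow> norm (g p) \<le> K * (1 + norm (Y p))"
    and K: "0 \<le> K"
    and Y: "\<And>z. z \<in> unit_sq \<Longrightarrow> Y z = box_integral g z + w z"
    and w: "\<And>z. z \<in> unit_sq \<Longrightarrow> norm (w z) \<le> S"
    and z: "z \<in> unit_sq"
  shows "norm (Y z) \<le> 2 * (S + K) * exp (2 * K + 1)"
proof -
  \<comment> \<open>The factor \<open>2\<close> yields \<open>K / l \<le> 1 / 2\<close>; the summand
    \<open>1\<close> keeps \<open>l\<close> positive when \<open>K = 0\<close>.\<close>
  define l where "l = 2 * K + 1"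
  have l: "0 < l" "K / l \<le> 1 / 2" using K by (auto simp: l_def field_simps)
  have sq: "compact unit_sq" "unit_sq \<noteq> {}"
    by (auto simp: unit_sq_def intro!: compact_Times)
  have "continuous_on unit_sq (\<lambda>z. norm (Y z) * exp (- l * fst z))"
    by (intro continuous_intros Y_cont)
  from continuous_attains_sup[OF sq this] obtain m where m: "m \<in> unit_sq"
    and max: "\<And>z. z \<in> unit_sq \<Longrightarrow> norm (Y z) * exp (- l * fst z) \<le> norm (Y m) * exp (- l * fst m)"
    by blast
  define A where "A = norm (Y m) * exp (- l * fst m)"
  have A0: "0 \<le> A" by (simp add: A_def)
  have Y_le: "norm (Y p) \<le> A * exp (l * fst p)" if "p \<in> unit_sq" for p
  proof -
    have "norm (Y p) = norm (Y p) * exp (- l * fst p) * exp (l * fst p)"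
      by (simp add: mult.assoc exp_add[symmetric])
    also have "\<dots> \<le> A * exp (l * fst p)"
      unfolding A_def by (intro mult_right_mono max that) simp
    finally show ?thesis .
  qed
  obtain s t where st: "m = (s, t)" "0 \<le> s" "s \<le> 1" "0 \<le> t" "t \<le> 1"
    using m by (auto simp: unit_sq_def)
  have sub: "p \<in> cbox 0 m \<Longrightarrow> p \<in> unit_sq" for p
    using st by (auto simp: mem_cbox_0 unit_sq_def mem_Times_iff)
  have int_e: "set_integrable lborel (cbox 0 m) (\<lambda>p. K * A * exp (l * fst p))"
    unfolding set_integrable_def
    by (intro borel_integrable_compact compact_cbox continuous_intros)
  have int_K: "set_integrable lborel (cbox 0 m) (\<lambda>p. K)"
    by (rule set_integrable_box[of _ "\<bar>K\<bar>"]) auto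
  have "norm (box_integral g m) \<le> (LINT p:cbox 0 m|lborel. norm (g p))"
    using box_integral_eq_set_integral[OF set_integrable_box_vec[OF g]] set_integral_norm_bound[OF set_integrable_box_vec[OF g]]
    by simp
  also have "\<dots> \<le> (LINT p:cbox 0 m|lborel. K + K * A * exp (l * fst p))"
  proof (rule set_integral_mono)
    show "set_integrable lborel (cbox 0 m) (\<lambda>p. norm (g p))"
      by (rule set_integrable_norm[OF set_integrable_box_vec[OF g]])
    show "set_integrable lborel (cbox 0 m) (\<lambda>p. K + K * A * exp (l * fst p))"
      by (rule set_integral_add(1)[OF int_K int_e])
    fix p assume "p \<in> cbox 0 m"
    then have p: "p \<in> unit_sq" by (rule sub)
    have "norm (g p) \<le> K * (1 + norm (Y p))" by (rule growth[OF p])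
    also have "\<dots> \<le> K * (1 + A * exp (l * fst p))"
      using Y_le[OF p] K by (intro mult_left_mono) auto
    finally show "norm (g p) \<le> K + K * A * exp (l * fst p)" by (simp add: algebra_simps)
  qed
  also have "\<dots> = K * (s * t) + K * A * ((exp (l * s) - 1) / l * t)"
  proof -
    have "(LINT p:cbox 0 m|lborel. K * A * exp (l * fst p)) = (LINT \<zeta>:{0..t}|lborel. K * A * ((exp (l * s) - 1) / l))"
      using int_e unfolding st(1)
      by (subst set_integral_box_iterated) (simp_all add: set_integral_exp[OF l(1) st(2)])
    also have "\<dots> = K * A * ((exp (l * s) - 1) / l * t)"
      using st by (simp add: set_lebesgue_integral_def)
    finally have "(LINT p:cbox 0 m|lborel. K * A * exp (l * fst p)) = K * A * ((exp (l * s) - 1) / l * t)" .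
    moreover have "(LINT p:cbox 0 m|lborel. K) = K * (s * t)"
      using set_lborel_integral_const[of m K] st by simp
    ultimately show ?thesis by (simp only: set_integral_add(2)[OF int_K int_e])
  qed
  \<comment> \<open>At most half of \<open>norm (Y m) = A * exp (l * s)\<close> comes back, and it
    is absorbed into the left-hand side below.\<close>
  also have "\<dots> \<le> K + A * exp (l * s) / 2"
  proof -
    have "K * (s * t) \<le> K * 1" using st K by (intro mult_left_mono mult_le_one) auto
    moreover have "K * A * ((exp (l * s) - 1) / l * t) \<le> A * exp (l * s) / 2"
    proof -
      have "(exp (l * s) - 1) / l * t \<le> exp (l * s) / l * 1"
        using st l by (intro mult_mono divide_right_mono) auto
      then have "K * A * ((exp (l * s) - 1) / l * t) \<le> K * A * (exp (l * s) / l)"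
        using K A0 by (intro mult_left_mono) auto
      also have "\<dots> = (K / l) * (A * exp (l * s))" by simp
      also have "\<dots> \<le> 1 / 2 * (A * exp (l * s))" using l A0 by (intro mult_right_mono) auto
      finally show ?thesis by simp
    qed
    ultimately show ?thesis by linarith
  qed
  finally have box: "norm (box_integral g m) \<le> K + A * exp (l * s) / 2" .
  have Sn: "0 \<le> S" using w[OF m] norm_ge_zero[of "w m"] by linarith
  have "A * exp (l * s) = norm (Y m)"
    by (simp add: A_def st(1) mult.assoc exp_add[symmetric])
  also have "\<dots> \<le> norm (box_integral g m) + norm (w m)"
    unfolding Y[OF m] by (rule norm_triangle_ineq)
  finally have tri: "A * exp (l * s) \<le> norm (box_integral g m) + norm (w m)" .
  then have "A * exp (l * s) \<le> 2 * (S + K)" using box w[OF m] by argo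
  moreover have "A * 1 \<le> A * exp (l * s)" using A0 l st by (intro mult_left_mono) auto
  ultimately have "A \<le> 2 * (S + K)" by linarith
  moreover have "exp (l * fst z) \<le> exp (2 * K + 1)"
    using z l(1) mult_left_le[of "fst z" l] by (auto simp: unit_sq_def l_def)
  ultimately have "A * exp (l * fst z) \<le> 2 * (S + K) * exp (2 * K + 1)"
    using A0 Sn K by (intro mult_mono) auto
  then show ?thesis using Y_le[OF z] by linarith
qed

text \<open>Clamping each component separately preserves monotonicity, whereas rescaling by the norm
  could destroy it.\<close>

definition truncated_drift ::
  "(real \<Rightarrow> real \<Rightarrow> real ^ 'd \<Rightarrow> real ^ 'd) \<Rightarrow> real \<Rightarrow> real \<times> real \<Rightarrow> real ^ 'd \<Rightarrow> real ^ 'd" where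
  "truncated_drift b R p x = (if p \<in> unit_sq then \<chi> i. max (- R) (min R (b (fst p) (snd p) x $ i)) else 0)"

lemma unit_sq_borel [measurable]: "unit_sq \<in> sets borel"
  unfolding unit_sq_def by (intro borel_closed closed_Times) auto

lemma drift_zero_extension_measurable:
  fixes b :: "real \<Rightarrow> real \<Rightarrow> real ^ 'd \<Rightarrow> real ^ 'd"
  assumes "(\<lambda>((s, t), x). b s t x) \<in> borel_measurable (restrict_space borel (unit_sq \<times> UNIV))"
  shows "(\<lambda>q. if fst q \<in> unit_sq then b (fst (fst q)) (snd (fst q)) (snd q) else 0) \<in> borel_measurable (borel \<Otimes>\<^sub>M borel)"
proof -
  have "unit_sq \<times> (UNIV :: (real ^ 'd) set) \<in> sets borel"
    unfolding unit_sq_def by (intro borel_closed closed_Times) auto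
  with assms have "(\<lambda>q. if q \<in> unit_sq \<times> UNIV then (\<lambda>((s, t), x). b s t x) q else 0) \<in> borel_measurable borel"
    by (subst (asm) measurable_restrict_space_iff[where c=0]) auto
  also have "(\<lambda>q. if q \<in> unit_sq \<times> UNIV then (\<lambda>((s, t), x). b s t x) q else 0) =
     (\<lambda>q. if fst q \<in> unit_sq then b (fst (fst q)) (snd (fst q)) (snd q) else 0)"
    by (auto simp: fun_eq_iff)
  finally show ?thesis by (simp add: borel_prod)
qed

lemma monotone_drift_truncated:
  fixes b :: "real \<Rightarrow> real \<Rightarrow> real ^ 'd \<Rightarrow> real ^ 'd"
  assumes b: "(\<lambda>((s, t), x). b s t x) \<in> borel_measurable (restrict_space borel (unit_sq \<times> UNIV))"
    and b_mono: "\<And>s t x y i. (s, t) \<in> unit_sq \<Longrightarrow> (\<forall>j. x $ j \<le> y $ j) \<Longrightarrow> b s t x $ i \<le> b s t y $ i"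
    and R: "0 \<le> R"
  shows "monotone_drift (truncated_drift b R) R"
proof
  note [measurable] = drift_zero_extension_measurable[OF b]
  show "(\<lambda>(p, x). truncated_drift b R p x) \<in> borel_measurable (borel \<Otimes>\<^sub>M borel)"
    unfolding split_beta'
  proof (rule borel_measurable_vecI)
    fix i
    have "(\<lambda>q. truncated_drift b R (fst q) (snd q) $ i) =
      (\<lambda>q. max (- R) (min R ((if fst q \<in> unit_sq then b (fst (fst q)) (snd (fst q)) (snd q) else 0) $ i)))"
      using R by (auto simp: fun_eq_iff truncated_drift_def)
    also have "\<dots> \<in> borel_measurable (borel \<Otimes>\<^sub>M borel)" by measurable
    finally show "(\<lambda>q. truncated_drift b R (fst q) (snd q) $ i) \<in> borel_measurable (borel \<Otimes>\<^sub>M borel)" .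
  qed
  show "\<bar>truncated_drift b R z x $ i\<bar> \<le> R" for z x i
    using R by (auto simp: truncated_drift_def)
  show "truncated_drift b R z x $ i \<le> truncated_drift b R z y $ i" if "\<And>j. x $ j \<le> y $ j" for x y z i
  proof (cases "z \<in> unit_sq")
    case True
    then have "b (fst z) (snd z) x $ i \<le> b (fst z) (snd z) y $ i"
      using that by (intro b_mono) auto
    then show ?thesis by (auto simp: truncated_drift_def)
  qed (simp add: truncated_drift_def)
qed

text \<open>Truncation keeps the growth constant, so the Gronwall bound is the same at every level
  and the level can be chosen after the bound.\<close>

lemma norm_truncated_drift_le: "p \<in> unit_sq \<Longrightarrow> 0 \<le> R \<Longrightarrow> norm (truncated_drift b R p x) \<le> norm (b (fst p) (snd p) x)"
  by (rule norm_le_componentwise_cart) (auto simp: truncated_drift_def)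

lemma truncated_drift_eq:
  assumes "p \<in> unit_sq" "norm (b (fst p) (snd p) x) \<le> R"
  shows "truncated_drift b R p x = b (fst p) (snd p) x"
proof (rule vec_eq_iff[THEN iffD2], rule allI)
  show "truncated_drift b R p x $ i = b (fst p) (snd p) x $ i" for i
    using component_le_norm_cart[of "b (fst p) (snd p) x" i] assms by (auto simp: truncated_drift_def)
qed

text \<open>Agreement on the square suffices, so a truncated or zero-extended integrand can be
  exchanged for the original drift.\<close>

lemma box_integral_iterated:
  fixes g :: "real \<times> real \<Rightarrow> real ^ 'd"
  assumes "g \<in> borel_measurable borel" "\<And>p i. \<bar>g p $ i\<bar> \<le> B" and st: "(s, t) \<in> unit_sq"
    and eq: "\<And>p. p \<in> unit_sq \<Longrightarrow> g p = f p"
  shows "box_integral g (s, t) = (LINT \<zeta>:{0..t}|lborel. LINT \<xi>:{0..s}|lborel. f (\<xi>, \<zeta>))"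
proof -
  have "box_integral g (s, t) = (LINT \<zeta>:{0..t}|lborel. LINT \<xi>:{0..s}|lborel. g (\<xi>, \<zeta>))"
    using set_integrable_box_vec[OF assms(1,2)] by (simp add: box_integral_eq_set_integral set_integral_box_iterated)
  also have "\<dots> = (LINT \<zeta>:{0..t}|lborel. LINT \<xi>:{0..s}|lborel. f (\<xi>, \<zeta>))"
  proof (intro set_lebesgue_integral_cong allI impI)
    fix \<zeta> \<xi> assume "\<zeta> \<in> {0..t}" "\<xi> \<in> {0..s}"
    then show "g (\<xi>, \<zeta>) = f (\<xi>, \<zeta>)" using st by (intro eq) (auto simp: unit_sq_def)
  qed simp_all
  finally show ?thesis .
qed

theorem mainTheorem1:
  fixes M :: "'w measure"
    and F :: "real \<times> real \<Rightarrow> 'w measure"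
    and W :: "real \<times> real \<Rightarrow> 'w \<Rightarrow> real ^ 'd"
    and b :: "real \<Rightarrow> real \<Rightarrow> real ^ 'd \<Rightarrow> real ^ 'd"
    and K :: real
  assumes "prob_space M"
    and "filtration2 M F"
    and "brownian_sheet M F W"
    and b_meas: "(\<lambda>((s, t), x). b s t x) \<in> borel_measurable (restrict_space borel (unit_sq \<times> UNIV))"
    and b_growth: "\<And>s t x. (s, t) \<in> unit_sq \<Longrightarrow> norm (b s t x) \<le> K * (1 + norm x)"
    and b_mono: "\<And>s t x y i. (s, t) \<in> unit_sq \<Longrightarrow> (\<forall>j. x $ j \<le> y $ j) \<Longrightarrow> b s t x $ i \<le> b s t y $ i"
  shows "\<exists>\<Omega>inf\<in>sets M. measure M \<Omega>inf = 1 \<and>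
           (\<forall>\<omega>\<in>\<Omega>inf. \<exists>X :: real \<times> real \<Rightarrow> real ^ 'd.
              (continuous_on unit_sq X \<and>
               (\<forall>s t. (s, t) \<in> unit_sq \<longrightarrow>
                  X (s, t) = (LINT \<zeta>:{0..t}|lborel. (LINT \<xi>:{0..s}|lborel. b \<xi> \<zeta> (X (\<xi>, \<zeta>))))
                             + W (s, t) \<omega>)) \<and>
              (\<forall>Y :: real \<times> real \<Rightarrow> real ^ 'd.
                 continuous_on unit_sq Y \<and>
                 (\<forall>s t. (s, t) \<in> unit_sq \<longrightarrow>
                    Y (s, t) = (LINT \<zeta>:{0..t}|lborel. (LINT \<xi>:{0..s}|lborel. b \<xi> \<zeta> (Y (\<xi>, \<zeta>))))
                               + W (s, t) \<omega>)
                 \<longrightarrow> (\<forall>z\<in>unit_sq. Y z = X z)))"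
proof -
  interpret brownian_sheet_space M F W
    using assms(1-3) by (simp add: brownian_sheet_space_def brownian_sheet_space_axioms_def)
  \<comment> \<open>The level needed depends on \<open>\<omega>\<close>; restricting to integer
    levels leaves countably many null sets to discard.\<close>
  define \<beta> where "\<beta> N = truncated_drift b (real (Suc N))" for N
  have drift: "monotone_drift (\<beta> N) (real (Suc N))" for N
    unfolding \<beta>_def by (rule monotone_drift_truncated[OF b_meas b_mono]) auto
  have K: "0 \<le> K"
    using order_trans[OF norm_ge_zero b_growth[of 0 0 0]] by (simp add: unit_sq_def)
  have growth: "norm (b (fst p) (snd p) x) \<le> K * (1 + norm x)" if "p \<in> unit_sq" for p x
    using that by (cases p) (auto intro: b_growth)
  define Good where "Good N \<omega> \<longleftrightarrow> (\<exists>X \<in> borel_measurable borel. continuous_on unit_sq X \<and>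
    (\<forall>z\<in>unit_sq. X z = box_integral (\<lambda>p. \<beta> N p (X p)) z + W z \<omega>) \<and>
    (\<forall>Y. (\<lambda>p. \<beta> N p (Y p)) \<in> borel_measurable borel \<longrightarrow>
      (\<forall>z\<in>unit_sq. Y z = box_integral (\<lambda>p. \<beta> N p (Y p)) z + W z \<omega>) \<longrightarrow> (\<forall>z\<in>unit_sq. Y z = X z)))" for N \<omega>
  have "AE \<omega> in M. \<forall>N. Good N \<omega>"
    unfolding Good_def AE_all_countable by (intro allI bounded_drift_unique_solution_AE[OF drift]) simp
  then obtain Null where Null: "{\<omega> \<in> space M. \<not> (\<forall>N. Good N \<omega>)} \<subseteq> Null" "emeasure M Null = 0" "Null \<in> sets M"
    by (rule AE_E)
  define \<Omega>inf where "\<Omega>inf = space M - Null"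
  have "\<Omega>inf \<in> sets M" "measure M \<Omega>inf = 1"
    using Null prob_compl[of Null] by (simp_all add: \<Omega>inf_def measure_def[of M Null])
  moreover have "\<exists>X :: real \<times> real \<Rightarrow> real ^ 'd.
              (continuous_on unit_sq X \<and>
               (\<forall>s t. (s, t) \<in> unit_sq \<longrightarrow>
                  X (s, t) = (LINT \<zeta>:{0..t}|lborel. (LINT \<xi>:{0..s}|lborel. b \<xi> \<zeta> (X (\<xi>, \<zeta>))))
                             + W (s, t) \<omega>)) \<and>
              (\<forall>Y :: real \<times> real \<Rightarrow> real ^ 'd.
                 continuous_on unit_sq Y \<and>
                 (\<forall>s t. (s, t) \<in> unit_sq \<longrightarrow>
                    Y (s, t) = (LINT \<zeta>:{0..t}|lborel. (LINT \<xi>:{0..s}|lborel. b \<xi> \<zeta> (Y (\<xi>, \<zeta>))))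
                               + W (s, t) \<omega>)
                 \<longrightarrow> (\<forall>z\<in>unit_sq. Y z = X z))" if "\<omega> \<in> \<Omega>inf" for \<omega>
  proof -
    have \<omega>: "\<omega> \<in> space M" "\<And>N. Good N \<omega>" using that Null(1) by (auto simp: \<Omega>inf_def)
    have compact_sq: "compact unit_sq"
      by (auto simp: unit_sq_def intro!: compact_Times)
    obtain S where S: "\<And>z. z \<in> unit_sq \<Longrightarrow> norm (W z \<omega>) \<le> S"
      using compact_imp_bounded[OF compact_continuous_image[OF W_continuous[OF \<omega>(1)] compact_sq]]
      by (auto simp: bounded_iff)
    \<comment> \<open>This is the conclusion of \<open>linear_growth_bound\<close> for the path of
      \<open>\<omega>\<close>, valid both for truncated solutions and for solutions of the original
      equation.\<close>
    define R where "R = 2 * (S + K) * exp (2 * K + 1)"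
    obtain N :: nat where "K * (1 + R) \<le> real N"
      using real_arch_simple by blast
    then have N: "K * (1 + R) \<le> real (Suc N)" by simp
    interpret monotone_drift "\<beta> N" "real (Suc N)" by (rule drift)
    have \<beta>_eq: "\<beta> N p x = b (fst p) (snd p) x" if "p \<in> unit_sq" "norm x \<le> R" for p x
      unfolding \<beta>_def
    proof (rule truncated_drift_eq[OF that(1)])
      have "norm (b (fst p) (snd p) x) \<le> K * (1 + norm x)" by (rule growth[OF that(1)])
      also have "\<dots> \<le> K * (1 + R)" using that K by (intro mult_left_mono) auto
      finally show "norm (b (fst p) (snd p) x) \<le> real (Suc N)" using N by linarith
    qed
    have \<beta>_growth: "norm (\<beta> N p x) \<le> K * (1 + norm x)" if "p \<in> unit_sq" for p x
      unfolding \<beta>_def using norm_truncated_drift_le[OF that] growth[OF that] by (rule order_trans) simp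
    from \<omega>(2)[of N] obtain X where X_meas [measurable]: "X \<in> borel_measurable borel"
      and X_cont: "continuous_on unit_sq X"
      and X: "\<And>z. z \<in> unit_sq \<Longrightarrow> X z = box_integral (\<lambda>p. \<beta> N p (X p)) z + W z \<omega>"
      and X_unique: "\<And>Y z. (\<lambda>p. \<beta> N p (Y p)) \<in> borel_measurable borel \<Longrightarrow>
        (\<And>z. z \<in> unit_sq \<Longrightarrow> Y z = box_integral (\<lambda>p. \<beta> N p (Y p)) z + W z \<omega>) \<Longrightarrow> z \<in> unit_sq \<Longrightarrow> Y z = X z"
      unfolding Good_def by blast
    have \<beta>X_meas: "(\<lambda>p. \<beta> N p (X p)) \<in> borel_measurable borel"
      by (rule drift_comp_measurable) measurable
    have X_bound: "norm (X z) \<le> R" if "z \<in> unit_sq" for z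
      unfolding R_def
      by (rule linear_growth_bound[OF X_cont \<beta>X_meas drift_bound \<beta>_growth K X S that])
    show ?thesis
    proof (intro exI[of _ X] conjI allI impI ballI)
      show "continuous_on unit_sq X" by (rule X_cont)
      show "X (s, t) = (LINT \<zeta>:{0..t}|lborel. (LINT \<xi>:{0..s}|lborel. b \<xi> \<zeta> (X (\<xi>, \<zeta>)))) + W (s, t) \<omega>"
        if st: "(s, t) \<in> unit_sq" for s t
        using X[OF st] box_integral_iterated[OF \<beta>X_meas drift_bound st \<beta>_eq[OF _ X_bound]] by simp
      fix Y z
      assume Y: "continuous_on unit_sq Y \<and> (\<forall>s t. (s, t) \<in> unit_sq \<longrightarrow>
          Y (s, t) = (LINT \<zeta>:{0..t}|lborel. (LINT \<xi>:{0..s}|lborel. b \<xi> \<zeta> (Y (\<xi>, \<zeta>)))) + W (s, t) \<omega>)"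
        and z: "z \<in> unit_sq"
      \<comment> \<open>Nothing is known about \<open>Y\<close> off the square, so the composed
        drift is cut to zero there before measurability is claimed.\<close>
      define g where "g p = (if p \<in> unit_sq then b (fst p) (snd p) (Y p) else 0)" for p
      have "(\<lambda>p. if p \<in> unit_sq then Y p else 0) \<in> borel_measurable borel"
      proof -
        have "(\<lambda>p. if p \<in> unit_sq then Y p else 0) = (\<lambda>p. indicat_real unit_sq p *\<^sub>R Y p)"
          by (auto simp: indicator_def)
        then show ?thesis
          using borel_measurable_continuous_on_indicator[OF unit_sq_borel conjunct1[OF Y]] by simp
      qed
      then have "(\<lambda>p. (p, if p \<in> unit_sq then Y p else 0)) \<in> borel \<rightarrow>\<^sub>M borel \<Otimes>\<^sub>M borel"
        by simp
      from measurable_compose[OF this drift_zero_extension_measurable[OF b_meas]]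
      have g_meas: "g \<in> borel_measurable borel"
        unfolding g_def[abs_def] by (simp cong: if_cong)
      obtain B where B: "\<And>p. p \<in> unit_sq \<Longrightarrow> norm (Y p) \<le> B"
        using compact_imp_bounded[OF compact_continuous_image[OF conjunct1[OF Y] compact_sq]]
        by (auto simp: bounded_iff)
      have g_growth: "norm (g p) \<le> K * (1 + norm (Y p))" for p
        using growth[of p "Y p"] K by (auto simp: g_def)
      have g_bound: "\<bar>g p $ i\<bar> \<le> K * (1 + \<bar>B\<bar>)" for p i
      proof (cases "p \<in> unit_sq")
        case True
        have "\<bar>g p $ i\<bar> \<le> norm (g p)" by (rule component_le_norm_cart)
        also have "\<dots> \<le> K * (1 + norm (Y p))" by (rule g_growth)
        also have "\<dots> \<le> K * (1 + \<bar>B\<bar>)" using B[OF True] K by (intro mult_left_mono) auto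
        finally show ?thesis .
      next
        case False
        then show ?thesis using K by (simp add: g_def)
      qed
      have Yg: "Y z = box_integral g z + W z \<omega>" if z: "z \<in> unit_sq" for z
      proof (cases z)
        case (Pair s t)
        have "box_integral g (s, t) = (LINT \<zeta>:{0..t}|lborel. LINT \<xi>:{0..s}|lborel. (\<lambda>p. b (fst p) (snd p) (Y p)) (\<xi>, \<zeta>))"
          by (rule box_integral_iterated[OF g_meas g_bound]) (use z Pair in \<open>auto simp: g_def\<close>)
        then show ?thesis using Y z unfolding Pair by simp
      qed
      have Y_bound: "norm (Y z) \<le> R" if "z \<in> unit_sq" for z
        unfolding R_def
        by (rule linear_growth_bound[OF conjunct1[OF Y] g_meas g_bound g_growth K Yg S that])
      \<comment> \<open>By the a priori bound the truncation is inactive along \<open>Y\<close>, and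
        both sides vanish off the square; uniqueness for the truncated drift then applies.\<close>
      have g_eq: "g = (\<lambda>p. \<beta> N p (Y p))"
      proof
        show "g p = \<beta> N p (Y p)" for p
          by (cases "p \<in> unit_sq") (simp_all add: g_def \<beta>_eq Y_bound, simp add: \<beta>_def truncated_drift_def)
      qed
      show "Y z = X z"
        using g_meas Yg z unfolding g_eq by (rule X_unique)
    qed
  qed
  ultimately show ?thesis by blast
qed

end
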